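(* Let $b\geq3$ and $t\geq2$ be integers that are multiplicatively independent (i.e. $\log b/\log t\notin\mathbb{Q}$) and have the same prime divisors. Let $D\subseteq\{0,1,\ldots,b-1\}$ with $\#D\ge 2$ contain at least one of $0$ and $b-1$, and suppose $D\subseteq\{0,1,\ldots,b-1\}\setminus(D_{1}\cup D_{2})$. Let $\psi:\mathbb{N}\to(0,\infty)$ satisfy $\psi(n)\le b^{-\lceil\alpha_{2}n\rceil-1}$ for all sufficiently large $n$. Then for every real $s\geq0$, $$\mathcal{H}^{s}(W_{t}(\psi)\cap C(b,D))=\begin{cases}0 & \text{if } \sum_{n=1}^{\infty}\psi(n)^{s}b^{\alpha_{1}\gamma n}<\infty,\\ +\infty & \text{if } \sum_{n=1}^{\infty}\psi(n)^{s}b^{\alpha_{1}\gamma n}=\infty.\end{cases}$$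
   Context: $C(b,D)$ denotes the set of real numbers in $[0,1]$ having a base-$b$ expansion all of whose digits lie in $D$. For an integer $u\geq2$ and $\psi:\mathbb{N}\to(0,\infty)$, $W_{u}(\psi)=\{x\in[0,1]: |x-p/u^{n}|<\psi(n)\text{ for infinitely many }(p,n)\in\mathbb{Z}\times\mathbb{N}\}$. $\gamma=\log\#D/\log b$. $\mathcal{H}^{s}$ is $s$-dimensional Hausdorff measure. For a prime $q$, $v_{q}(m)$ is the largest integer $v$ with $q^{v}\mid m$. $\alpha_{1}=\min\{v_{q}(t)/v_{q}(b): q \text{ prime}, q\mid b\}$, $\alpha_{2}=\max\{v_{q}(t)/v_{q}(b): q\text{ prime}, q\mid b\}$. Let $b_{*}=b\big/\prod q^{v_{q}(b)}$, the product over primes $q\mid b$ with $v_{q}(t)/v_{q}(b)>\alpha_{1}$. Then $D_{1}=\{kb_{*}: 1\le k\le b/b_{*}-1\}$ and $D_{2}=\{kb_{*}-1: 1\le k\le b/b_{*}-1\}$. *)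

theory Defs
  imports "HOL-Analysis.Analysis" "HOL-Computational_Algebra.Primes"
begin

section \<open>Hausdorff measure\<close>

text \<open>
  The s-th power of the diameter, with the usual conventions that the empty set contributes 0 for
  every s and that a nonempty set contributes 1 for s = 0. The library has \<open>0 powr 0 = 0\<close>,
  so the case s = 0 is separate; with it, the 0-dimensional measure is counting measure.
\<close>

definition diam_pow :: "real \<Rightarrow> 'a::metric_space set \<Rightarrow> ennreal" where
  "diam_pow s U =
     (if U = {} then 0 else if s = 0 then 1 else ennreal (diameter U powr s))"

text \<open>
  Countable covers by sets of diameter at most \<open>\<delta>\<close>. Some of the sets may be empty, so finite covers
  are included. Boundedness is required because \<open>diameter\<close> is unspecified on unbounded sets.
\<close>

definition delta_covers :: "real \<Rightarrow> 'a::metric_space set \<Rightarrow> (nat \<Rightarrow> 'a set) set" where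
  "delta_covers \<delta> A =
     {U. A \<subseteq> (\<Union>i. U i) \<and> (\<forall>i. bounded (U i) \<and> diameter (U i) \<le> \<delta>)}"

definition hausdorff_pre :: "real \<Rightarrow> real \<Rightarrow> 'a::metric_space set \<Rightarrow> ennreal" where
  "hausdorff_pre s \<delta> A = (INF U\<in>delta_covers \<delta> A. \<Sum>i. diam_pow s (U i))"

definition hausdorff_measure :: "real \<Rightarrow> 'a::metric_space set \<Rightarrow> ennreal" where
  "hausdorff_measure s A = (SUP \<delta>\<in>{0<..}. hausdorff_pre s \<delta> A)"

section \<open>Missing-digit sets and well-approximable numbers\<close>

definition missing_digit_set :: "nat \<Rightarrow> nat set \<Rightarrow> real set" where
  "missing_digit_set b D =
     {x \<in> {0..1}. \<exists>d :: nat \<Rightarrow> nat. (\<forall>i. d i \<in> D) \<and> (\<lambda>i. real (d i) / real b ^ Suc i) sums x}"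

text \<open>The exponents n are positive; only the values of \<open>\<psi>\<close> at positive arguments matter.\<close>

definition well_approx :: "nat \<Rightarrow> (nat \<Rightarrow> real) \<Rightarrow> real set" where
  "well_approx u \<psi> =
     {x \<in> {0..1}.
        infinite {(p :: int, n :: nat). 1 \<le> n \<and> \<bar>x - real_of_int p / real u ^ n\<bar> < \<psi> n}}"

section \<open>Arithmetic of the two bases\<close>

definition val_ratio :: "nat \<Rightarrow> nat \<Rightarrow> nat \<Rightarrow> real" where
  "val_ratio b t q = real (multiplicity q t) / real (multiplicity q b)"

definition alpha_min :: "nat \<Rightarrow> nat \<Rightarrow> real" where
  "alpha_min b t = Min {val_ratio b t q | q. prime q \<and> q dvd b}"

definition alpha_max :: "nat \<Rightarrow> nat \<Rightarrow> real" where
  "alpha_max b t = Max {val_ratio b t q | q. prime q \<and> q dvd b}"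

text \<open>The division is exact.\<close>

definition b_star :: "nat \<Rightarrow> nat \<Rightarrow> nat" where
  "b_star b t =
     b div (\<Prod>q | prime q \<and> q dvd b \<and> val_ratio b t q > alpha_min b t. q ^ multiplicity q b)"

definition D1 :: "nat \<Rightarrow> nat \<Rightarrow> nat set" where
  "D1 b t = {k * b_star b t | k. 1 \<le> k \<and> k \<le> b div b_star b t - 1}"

definition D2 :: "nat \<Rightarrow> nat \<Rightarrow> nat set" where
  "D2 b t = {k * b_star b t - 1 | k. 1 \<le> k \<and> k \<le> b div b_star b t - 1}"

definition digit_dim :: "nat \<Rightarrow> nat set \<Rightarrow> real" where
  "digit_dim b D = ln (real (card D)) / ln (real b)"

end

theory Submission
  imports Defs "HOL-Probability.Probability"
begin

text \<open>
  Write \<open>m = \<lceil>alpha_max b t * n\<rceil>\<close>. Since \<open>t ^ n\<close> divides \<open>b ^ m\<close>, a rational \<open>p / t ^ n\<close> is \<open>a / b ^ m\<close>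
  for an integer \<open>a\<close>, and \<open>a\<close> is divisible by \<open>b_star b t ^ k\<close> for \<open>k\<close> close to
  \<open>(alpha_max b t - alpha_min b t) * n\<close>. If it is very close to a point of the missing digit set, then
  \<open>a\<close> or \<open>a - 1\<close> has all its digits in \<open>D\<close>, and the restriction on \<open>D\<close> forces its last \<open>k\<close> digits to
  be \<open>0\<close>, respectively \<open>b - 1\<close>. Hence only about \<open>card D ^ (alpha_min b t * n)\<close> rationals matter for
  each \<open>n\<close>, and the convergence case is a covering argument.

  For divergence, \<open>x\<close> lies in the set as soon as, for infinitely many \<open>n\<close>, its digits are equal to a
  fixed \<open>e \<in> {0, b - 1} \<inter> D\<close> on an interval \<open>{l n..<m n}\<close> with \<open>l n = \<lfloor>alpha_min b t * n\<rfloor>\<close> and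
  \<open>b ^ - m n\<close> of the order of \<open>\<psi> n\<close>. A random digit sequence of this kind is built from independent
  blocks: in each block one \<open>n\<close> is drawn with probability proportional to
  \<open>card D ^ (alpha_min b t * n) * b ^ (- s * m n)\<close> and all digits outside \<open>{l n..<m n}\<close> are uniform.
  Divergence makes the normalising constants as large as desired, so that cylinders of length \<open>k\<close> have
  mass at most \<open>\<epsilon> * b ^ (- s * k)\<close>, and the mass distribution principle gives infinite measure.
\<close>

section \<open>Digit expansions\<close>

text \<open>Horner form with the leading digit first. For digits below \<open>b\<close>, dividing
  \<open>prefix_val b d m\<close> and \<open>prefix_val b d m + 1\<close> by \<open>b ^ m\<close>
  gives the endpoints of the b-adic interval of order m that holds the number with digits
  \<open>d\<close>.\<close>

primrec prefix_val :: "nat \<Rightarrow> (nat \<Rightarrow> nat) \<Rightarrow> nat \<Rightarrow> nat" where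
  "prefix_val b d 0 = 0"
| "prefix_val b d (Suc m) = b * prefix_val b d m + d m"

lemma sum_digits_eq_prefix_val:
  assumes "b > 0"
  shows "(\<Sum>i<m. real (d i) / real b ^ Suc i) = real (prefix_val b d m) / real b ^ m"
  using assms by (induction m) (auto simp: field_simps)

lemma prefix_val_add_ge: "b ^ k * prefix_val b d m \<le> prefix_val b d (m + k)"
proof (induction k)
  case (Suc k)
  have "b ^ Suc k * prefix_val b d m = b * (b ^ k * prefix_val b d m)" by simp
  also have "\<dots> \<le> b * prefix_val b d (m + k)" using Suc by (rule mult_le_mono2)
  also have "\<dots> \<le> prefix_val b d (m + Suc k)" by simp
  finally show ?case .
qed simp

lemma prefix_val_add_lt:
  assumes "\<And>i. d i < b"
  shows "prefix_val b d (m + k) < b ^ k * (prefix_val b d m + 1)"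
proof (induction k)
  case (Suc k)
  have "prefix_val b d (m + Suc k) < b * (prefix_val b d (m + k) + 1)"
    using assms[of "m + k"] by simp
  also have "\<dots> \<le> b * (b ^ k * (prefix_val b d m + 1))"
    using Suc by (intro mult_le_mono2) simp
  finally show ?case by (simp add: algebra_simps)
qed simp

text \<open>All truncations to at least m digits lie in the same b-adic interval of order m, and
  closed bounds pass to the limit. The upper bound is attained when every digit from position m on
  is \<open>b - 1\<close>.\<close>

lemma digits_sums_bounds:
  assumes "\<And>i. d i < b" and "(\<lambda>i. real (d i) / real b ^ Suc i) sums x"
  shows "real (prefix_val b d m) \<le> real b ^ m * x" and "real b ^ m * x \<le> real (prefix_val b d m) + 1"
proof -
  have b: "b > 0" using assms(1)[of 0] by simp
  have lim: "(\<lambda>M. real (prefix_val b d M) / real b ^ M) \<longlonglongrightarrow> x"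
    using assms(2) unfolding sums_def sum_digits_eq_prefix_val[OF b] .
  have lo: "real (prefix_val b d m) / real b ^ m \<le> real (prefix_val b d M) / real b ^ M"
    and hi: "real (prefix_val b d M) / real b ^ M \<le> (real (prefix_val b d m) + 1) / real b ^ m"
    if "M \<ge> m" for M
  proof -
    have M: "M = m + (M - m)" using that by simp
    have pw: "real b ^ M = real b ^ m * real b ^ (M - m)" by (subst M) (rule power_add)
    have "b ^ (M - m) * prefix_val b d m \<le> prefix_val b d M"
      using prefix_val_add_ge[of b "M - m" d m] M by simp
    hence "real b ^ (M - m) * real (prefix_val b d m) \<le> real (prefix_val b d M)"
      by (metis of_nat_le_iff of_nat_mult of_nat_power)
    thus "real (prefix_val b d m) / real b ^ m \<le> real (prefix_val b d M) / real b ^ M"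
      using b by (simp add: pw field_simps)
    have "prefix_val b d M \<le> b ^ (M - m) * (prefix_val b d m + 1)"
      using prefix_val_add_lt[of d b m "M - m"] assms(1) M by simp
    from of_nat_mono[OF this, where 'a = real]
    have "real (prefix_val b d M) \<le> real b ^ (M - m) * (real (prefix_val b d m) + 1)" by (simp add: algebra_simps)
    thus "real (prefix_val b d M) / real b ^ M \<le> (real (prefix_val b d m) + 1) / real b ^ m"
      using b by (simp add: pw field_simps)
  qed
  have "real (prefix_val b d m) / real b ^ m \<le> x"
    by (rule LIMSEQ_le_const[OF lim]) (use lo in blast)
  thus "real (prefix_val b d m) \<le> real b ^ m * x" using b by (simp add: field_simps)
  have "x \<le> (real (prefix_val b d m) + 1) / real b ^ m"
    by (rule LIMSEQ_le_const2[OF lim]) (use hi in blast)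
  thus "real b ^ m * x \<le> real (prefix_val b d m) + 1" using b by (simp add: field_simps)
qed

lemma summable_digits:
  assumes "b \<ge> 2" and "\<And>i. d i < b"
  shows "summable (\<lambda>i. real (d i) / real b ^ Suc i)"
proof (rule summable_comparison_test')
  show "summable (\<lambda>i. (1 / real b) ^ i)" using assms(1) by (intro summable_geometric) auto
  show "norm (real (d i) / real b ^ Suc i) \<le> (1 / real b) ^ i" for i
    using assms(2)[of i] assms(1) by (simp add: field_simps)
qed

lemma prefix_val_inj:
  assumes "\<And>i. d i < b" "\<And>i. d' i < b" and "prefix_val b d m = prefix_val b d' m" and "i < m"
  shows "d i = d' i"
  using assms(3,4)
proof (induction m)
  case (Suc m)
  have eq: "b * prefix_val b d m + d m = b * prefix_val b d' m + d' m" using Suc.prems(1) by simp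
  have "(b * prefix_val b d m + d m) mod b = (b * prefix_val b d' m + d' m) mod b"
    by (simp only: eq)
  hence dm: "d m = d' m" using assms(1,2) by simp
  moreover have "b > 0" using assms(1)[of 0] by simp
  ultimately have "prefix_val b d m = prefix_val b d' m" using eq by simp
  thus ?case using Suc dm by (cases "i = m") auto
qed simp

section \<open>Counting the prefixes with digits in D\<close>

definition prefix_vals :: "nat \<Rightarrow> nat set \<Rightarrow> nat \<Rightarrow> nat set" where
  "prefix_vals b D m = {prefix_val b d m | d. \<forall>i. d i \<in> D}"

lemma prefix_vals_finite_card:
  assumes "finite D"
  shows "finite (prefix_vals b D m) \<and> card (prefix_vals b D m) \<le> card D ^ m"
proof (induction m)
  case 0
  have "prefix_vals b D 0 \<subseteq> {0}" by (auto simp: prefix_vals_def)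
  thus ?case using finite_subset card_mono[of "{0::nat}" "prefix_vals b D 0"] by fastforce
next
  case (Suc m)
  have sub: "prefix_vals b D (Suc m) \<subseteq> (\<lambda>(a, c). b * a + c) ` (prefix_vals b D m \<times> D)"
    unfolding prefix_vals_def by fastforce
  have fin: "finite (prefix_vals b D m \<times> D)" using Suc assms by simp
  have "card (prefix_vals b D (Suc m)) \<le> card (prefix_vals b D m \<times> D)"
    using surj_card_le[OF fin sub] .
  also have "\<dots> \<le> card D ^ m * card D" using Suc by (simp add: card_cartesian_product)
  finally show ?case using finite_subset[OF sub] fin by (simp add: mult.commute)
qed

lemma prefix_val_const_zero:
  assumes "l \<le> m" and "\<And>i. i \<in> {l..<m} \<Longrightarrow> d i = 0"
  shows "prefix_val b d m = b ^ (m - l) * prefix_val b d l"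
  using assms
proof (induction m)
  case (Suc m)
  thus ?case by (cases "l = Suc m") (auto simp: Suc_diff_le)
qed simp

text \<open>A run of the digit \<open>b - 1\<close> becomes a run of zeros after adding 1, so here
  the right endpoint of the b-adic interval is the one with a shorter expansion.\<close>

lemma prefix_val_const_max:
  assumes "l \<le> m" and "b > 0" and "\<And>i. i \<in> {l..<m} \<Longrightarrow> d i = b - 1"
  shows "prefix_val b d m + 1 = b ^ (m - l) * (prefix_val b d l + 1)"
  using assms
proof (induction m)
  case (Suc m)
  show ?case
  proof (cases "l = Suc m")
    case False
    hence lm: "l \<le> m" using Suc.prems(1) by simp
    have "prefix_val b d (Suc m) + 1 = b * (prefix_val b d m + 1)"
      using Suc.prems(2) Suc.prems(3)[of m] lm by simp
    also have "prefix_val b d m + 1 = b ^ (m - l) * (prefix_val b d l + 1)"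
      using Suc lm by simp
    finally show ?thesis using lm by (simp add: Suc_diff_le algebra_simps)
  qed auto
qed simp

lemma missing_digit_setI:
  assumes "b \<ge> 2" "\<And>i. d i < b" "\<And>i. d i \<in> D" "(\<lambda>i. real (d i) / real b ^ Suc i) sums x"
  shows "x \<in> missing_digit_set b D"
  using digits_sums_bounds[OF assms(2,4), of 0] assms(3,4)
  unfolding missing_digit_set_def by auto

section \<open>Divisibility between powers of the two bases\<close>

text \<open>The last digit is a multiple of \<open>c\<close> below \<open>b\<close>, and the nonzero
  ones are excluded, so it is 0. Removing it divides the number by \<open>b = c * u\<close>; one
  factor \<open>c\<close> is spent, and coprimality with \<open>u\<close> leaves
  \<open>c ^ k\<close> for the remaining digits.\<close>

lemma coprime_divisor_prefix_val:
  assumes "c * u = b" "coprime c u" "\<And>i. d i < b"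
    and "\<And>i k. 1 \<le> k \<Longrightarrow> k \<le> u - 1 \<Longrightarrow> d i \<noteq> k * c"
    and "c ^ k dvd prefix_val b d m" and "k \<le> m"
  shows "prefix_val b d m = b ^ k * prefix_val b d (m - k)"
  using assms(5,6)
proof (induction k arbitrary: m)
  case (Suc k)
  then obtain m' where m: "m = Suc m'" by (cases m) auto
  have pos: "c > 0" "u > 0" using assms(1) assms(3)[of 0] by (auto intro!: Nat.gr0I)
  have "c dvd b * prefix_val b d m' + d m'"
    using Suc.prems(1) m by (auto intro: dvd_trans[rotated])
  moreover have "c dvd b * prefix_val b d m'" using assms(1) by auto
  ultimately have "c dvd d m'" using dvd_add_right_iff by blast
  then obtain j where j: "d m' = j * c" by (metis dvdE mult.commute)
  have "j * c < u * c" using assms(3)[of m'] assms(1) j by (simp add: mult.commute)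
  hence "j < u" by simp
  hence "j = 0" using assms(4)[of j m'] j by fastforce
  hence d0: "d m' = 0" using j by simp
  have "c * c ^ k dvd c * (u * prefix_val b d m')"
    using Suc.prems(1) d0 m assms(1) by (simp add: mult.assoc[symmetric])
  hence "c ^ k dvd u * prefix_val b d m'" using pos by simp
  hence "c ^ k dvd prefix_val b d m'"
    using assms(2) by (simp add: coprime_dvd_mult_right_iff)
  hence "prefix_val b d m' = b ^ k * prefix_val b d (m' - k)" using Suc m by auto
  thus ?case using d0 m by simp
qed simp

text \<open>The same descent on right endpoints. The last digit plus 1 is a multiple of
  \<open>c\<close> between 1 and \<open>b\<close>; only \<open>b\<close> itself is not excluded, so
  the last digit is \<open>b - 1\<close> and the added 1 is carried to the shorter prefix.\<close>

lemma coprime_divisor_prefix_val_Suc: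
  assumes "c * u = b" "coprime c u" "\<And>i. d i < b"
    and "\<And>i k. 1 \<le> k \<Longrightarrow> k \<le> u - 1 \<Longrightarrow> d i \<noteq> k * c - 1"
    and "c ^ k dvd prefix_val b d m + 1" and "k \<le> m"
  shows "prefix_val b d m + 1 = b ^ k * (prefix_val b d (m - k) + 1)"
  using assms(5,6)
proof (induction k arbitrary: m)
  case (Suc k)
  then obtain m' where m: "m = Suc m'" by (cases m) auto
  have pos: "c > 0" "u > 0" using assms(1) assms(3)[of 0] by (auto intro!: Nat.gr0I)
  have "c dvd b * prefix_val b d m' + (d m' + 1)"
    using Suc.prems(1) m by (auto intro: dvd_trans[rotated])
  moreover have "c dvd b * prefix_val b d m'" using assms(1) by auto
  ultimately have "c dvd d m' + 1" using dvd_add_right_iff by blast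
  then obtain j where j: "d m' + 1 = j * c" by (metis dvdE mult.commute)
  have "j * c \<le> u * c" using assms(3)[of m'] assms(1) j by (simp add: mult.commute)
  hence "j \<le> u" using pos by simp
  moreover have "j \<ge> 1" using j by (cases j) auto
  moreover have "d m' = j * c - 1" using j by simp
  ultimately have "j = u" using assms(4)[of j m'] by fastforce
  hence d0: "d m' + 1 = b" using j assms(1) by (simp add: mult.commute)
  have eq: "prefix_val b d m + 1 = b * (prefix_val b d m' + 1)" using d0 m by simp
  have "c * c ^ k dvd c * (u * (prefix_val b d m' + 1))"
    using Suc.prems(1) eq assms(1) by (simp only: mult.assoc[symmetric] power_Suc)
  hence "c ^ k dvd u * (prefix_val b d m' + 1)" using pos by simp
  hence "c ^ k dvd prefix_val b d m' + 1"
    using assms(2) by (metis coprime_dvd_mult_right_iff coprime_power_left_iff)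
  hence "prefix_val b d m' + 1 = b ^ k * (prefix_val b d (m' - k) + 1)" using Suc m by auto
  thus ?case using eq m by (simp add: algebra_simps)
qed simp

section \<open>Prime exponents in the powers of b and t\<close>

locale same_primes =
  fixes b t :: nat
  assumes b_ge: "b \<ge> 2" and t_ge: "t \<ge> 2"
    and prime_dvd_iff: "\<And>q :: nat. prime q \<Longrightarrow> q dvd b \<longleftrightarrow> q dvd t"
begin

lemma ratios: "finite {val_ratio b t q | q. prime q \<and> q dvd b}"
  "{val_ratio b t q | q. prime q \<and> q dvd b} \<noteq> {}"
proof -
  have "finite {q. q dvd b}" using b_ge by (intro finite_divisors_nat) simp
  hence "finite {q. prime q \<and> q dvd b}" by (rule rev_finite_subset) auto
  thus "finite {val_ratio b t q | q. prime q \<and> q dvd b}" by simp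
  show "{val_ratio b t q | q. prime q \<and> q dvd b} \<noteq> {}"
    using prime_factor_nat[of b] b_ge by auto
qed

lemma multiplicity_pos:
  assumes "prime q" "q dvd b"
  shows "multiplicity q b > 0" "multiplicity q t > 0"
  using assms prime_dvd_iff[OF assms(1)] b_ge t_ge by (auto simp: prime_multiplicity_gt_zero_iff)

lemma multiplicity_not_dvd:
  assumes "prime q" "\<not> q dvd b"
  shows "multiplicity q b = 0" "multiplicity q t = 0"
  using assms prime_dvd_iff[OF assms(1)] by (auto intro: not_dvd_imp_multiplicity_0)

lemma val_ratio_bounds:
  assumes "prime q" "q dvd b"
  shows "alpha_min b t \<le> val_ratio b t q" "val_ratio b t q \<le> alpha_max b t"
  unfolding alpha_min_def alpha_max_def using ratios assms by (auto intro: Min_le Max_ge)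

text \<open>A prime that does not divide \<open>b\<close> has multiplicity 0 in both bases, so the
  convention for division by 0 does no harm and the identity holds at every prime.\<close>

lemma val_ratio_times:
  assumes "prime q"
  shows "real (multiplicity q t) = val_ratio b t q * real (multiplicity q b)"
  using multiplicity_pos[of q] multiplicity_not_dvd[of q] assms
  by (cases "q dvd b") (auto simp: val_ratio_def)

lemma alpha_min_attained: "\<exists>q. prime q \<and> q dvd b \<and> val_ratio b t q = alpha_min b t"
proof -
  have "alpha_min b t \<in> {val_ratio b t q | q. prime q \<and> q dvd b}"
    using Min_in[OF ratios] unfolding alpha_min_def .
  thus ?thesis by auto
qed

lemma alpha_min_pos: "alpha_min b t > 0"
proof -
  obtain q where q: "prime q" "q dvd b" "val_ratio b t q = alpha_min b t"
    using alpha_min_attained by blast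
  show ?thesis using multiplicity_pos[OF q(1,2)] q(3)[symmetric] by (simp add: val_ratio_def)
qed

text \<open>If the extremes coincide, all exponents of \<open>t\<close> are in one fixed ratio u/v
  to those of \<open>b\<close>; unique factorisation gives \<open>t ^ v = b ^ u\<close>, and the
  quotient of logarithms is rational.\<close>

lemma alpha_min_less_max:
  assumes "ln (real b) / ln (real t) \<notin> \<rat>"
  shows "alpha_min b t < alpha_max b t"
proof (rule ccontr)
  assume "\<not> ?thesis"
  moreover obtain q where q: "prime q" "q dvd b" "val_ratio b t q = alpha_min b t"
    using alpha_min_attained by blast
  ultimately have eq: "val_ratio b t p = val_ratio b t q" if "prime p" "p dvd b" for p
    using val_ratio_bounds[OF that] by linarith
  define u v where "u = multiplicity q t" and "v = multiplicity q b"
  have uv: "u > 0" "v > 0" using multiplicity_pos[OF q(1,2)] by (simp_all add: u_def v_def)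
  have "normalize (t ^ v) = normalize (b ^ u)"
  proof (rule multiplicity_eq_imp_eq)
    fix p :: nat assume p: "prime p"
    have "multiplicity p t * v = u * multiplicity p b"
    proof (cases "p dvd b")
      case True
      have "real (multiplicity p t) = real u / real v * real (multiplicity p b)"
        unfolding val_ratio_times[OF p] eq[OF p True] by (simp add: u_def v_def val_ratio_def)
      hence "real (multiplicity p t * v) = real (u * multiplicity p b)"
        using uv by (simp add: field_simps)
      thus ?thesis by (simp only: of_nat_eq_iff)
    qed (use multiplicity_not_dvd[OF p] in simp)
    thus "multiplicity p (t ^ v) = multiplicity p (b ^ u)"
      using p b_ge t_ge by (simp add: prime_elem_multiplicity_power_distrib mult.commute)
  qed (use b_ge t_ge in auto)
  hence "t ^ v = b ^ u" by simp
  hence "real t ^ v = real b ^ u" by (metis of_nat_power)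
  hence "ln (real t ^ v) = ln (real b ^ u)" by simp
  hence "real v * ln (real t) = real u * ln (real b)"
    using b_ge t_ge by (simp add: ln_realpow)
  hence "ln (real b) / ln (real t) = real v / real u"
    using uv t_ge by (simp add: field_simps)
  thus False using assms by simp
qed

text \<open>In \<open>t ^ n\<close> every prime exponent is at least
  \<open>alpha_min b t * n\<close> times its exponent in \<open>b\<close>. Hence each fraction with
  denominator \<open>b ^ l\<close> can be written with denominator \<open>t ^ n\<close>.\<close>

lemma power_dvd_power:
  assumes "real l \<le> alpha_min b t * real n"
  shows "b ^ l dvd t ^ n"
proof (rule multiplicity_le_imp_dvd)
  fix q :: nat assume q: "prime q"
  have "l * multiplicity q b \<le> n * multiplicity q t"
  proof (cases "q dvd b")
    case True
    have "real l \<le> val_ratio b t q * real n"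
      using assms val_ratio_bounds(1)[OF q True] by (meson mult_right_mono of_nat_0_le_iff order_trans)
    hence "real l * real (multiplicity q b) \<le> val_ratio b t q * real n * real (multiplicity q b)"
      by (rule mult_right_mono) simp
    hence "real (l * multiplicity q b) \<le> real (n * multiplicity q t)"
      using val_ratio_times[OF q] by (simp add: mult_ac)
    thus ?thesis by (simp only: of_nat_le_iff)
  qed (use multiplicity_not_dvd[OF q] in simp)
  thus "multiplicity q (b ^ l) \<le> multiplicity q (t ^ n)"
    using q b_ge t_ge by (simp add: prime_elem_multiplicity_power_distrib)
qed (use b_ge in simp)

text \<open>The cofactor of \<open>b_star b t\<close> in \<open>b\<close>: it collects the primes
  whose exponent in \<open>t ^ n\<close> grows faster than the minimal rate.\<close>

definition fast_part :: nat where
  "fast_part = (\<Prod>q | prime q \<and> q dvd b \<and> val_ratio b t q > alpha_min b t. q ^ multiplicity q b)"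

lemma multiplicity_fast_part:
  assumes "prime p"
  shows "multiplicity p fast_part =
    (if p dvd b \<and> val_ratio b t p > alpha_min b t then multiplicity p b else 0)"
proof -
  have "finite {q. q dvd b}" using b_ge by (intro finite_divisors_nat) simp
  hence "finite {q. prime q \<and> q dvd b \<and> val_ratio b t q > alpha_min b t}"
    by (rule rev_finite_subset) auto
  thus ?thesis unfolding fast_part_def using assms
    by (subst multiplicity_prod_prime_powers) auto
qed

lemma fast_part_pos: "fast_part > 0"
  unfolding fast_part_def by (intro prod_pos) (auto simp: prime_gt_0_nat)

lemma b_star_times_fast_part: "b_star b t * fast_part = b"
proof -
  have "fast_part dvd b"
    by (rule multiplicity_le_imp_dvd) (use fast_part_pos multiplicity_fast_part in auto)
  thus ?thesis unfolding b_star_def fast_part_def by simp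
qed

lemma multiplicity_b_star:
  assumes "prime p"
  shows "multiplicity p (b_star b t) =
    (if p dvd b \<and> val_ratio b t p > alpha_min b t then 0 else multiplicity p b)"
proof -
  have "multiplicity p b = multiplicity p (b_star b t) + multiplicity p fast_part"
    using b_star_times_fast_part b_ge fast_part_pos assms
    by (metis prime_elem_multiplicity_mult_distrib mult_is_0 not_numeral_le_zero prime_imp_prime_elem)
  thus ?thesis using multiplicity_fast_part[OF assms] by auto
qed

lemma b_star_pos: "b_star b t > 0"
  using b_star_times_fast_part b_ge by (intro Nat.gr0I) simp

lemma coprime_b_star_fast_part: "coprime (b_star b t) fast_part"
proof (rule coprimeI)
  fix c assume c: "c dvd b_star b t" "c dvd fast_part"
  show "is_unit c"
  proof (rule ccontr)
    assume "\<not> is_unit c"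
    then obtain p where p: "prime p" "p dvd c" using prime_factor_nat[of c] by auto
    hence "p dvd b_star b t" "p dvd fast_part" using c dvd_trans by blast+
    hence "multiplicity p (b_star b t) > 0" "multiplicity p fast_part > 0"
      using p(1) b_star_pos fast_part_pos by (auto simp: prime_multiplicity_gt_zero_iff)
    thus False using multiplicity_b_star[OF p(1)] multiplicity_fast_part[OF p(1)]
      by (auto split: if_splits)
  qed
qed

text \<open>Identifies the upper end of the range of multipliers in \<open>D1\<close> and
  \<open>D2\<close> as \<open>fast_part - 1\<close>, the form used by the descent on digits.\<close>

lemma b_div_b_star: "b div b_star b t = fast_part"
  using b_star_times_fast_part b_star_pos by (metis nonzero_mult_div_cancel_left less_not_refl)

text \<open>At the fast primes \<open>b_star b t\<close> contributes nothing and the first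
  hypothesis suffices. At the other primes the ratio is exactly \<open>alpha_min b t\<close>, which
  leaves room for \<open>k\<close> further copies by the second hypothesis.\<close>

lemma power_times_b_star_dvd:
  assumes "alpha_max b t * real n \<le> real m" and "alpha_min b t * real n + real k \<le> real m"
  shows "t ^ n * b_star b t ^ k dvd b ^ m"
proof (rule multiplicity_le_imp_dvd)
  fix q :: nat assume q: "prime q"
  have "n * multiplicity q t + k * multiplicity q (b_star b t) \<le> m * multiplicity q b"
  proof (cases "q dvd b")
    case True
    show ?thesis
    proof (cases "val_ratio b t q > alpha_min b t")
      case gt: True
      have "val_ratio b t q * real n \<le> real m"
        using assms(1) val_ratio_bounds(2)[OF q True]
        by (meson mult_right_mono of_nat_0_le_iff order_trans)
      hence "val_ratio b t q * real n * real (multiplicity q b) \<le> real m * real (multiplicity q b)"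
        by (rule mult_right_mono) simp
      hence "real (n * multiplicity q t) \<le> real (m * multiplicity q b)"
        using val_ratio_times[OF q] by (simp add: mult_ac)
      thus ?thesis using multiplicity_b_star[OF q] gt True by (simp only: of_nat_le_iff) simp
    next
      case False
      hence eq: "val_ratio b t q = alpha_min b t" using val_ratio_bounds(1)[OF q True] by linarith
      have "(alpha_min b t * real n + real k) * real (multiplicity q b)
          \<le> real m * real (multiplicity q b)"
        using assms(2) by (rule mult_right_mono) simp
      hence "real (n * multiplicity q t + k * multiplicity q b) \<le> real (m * multiplicity q b)"
        using val_ratio_times[OF q] eq by (simp add: algebra_simps)
      thus ?thesis using multiplicity_b_star[OF q] False by (simp only: of_nat_le_iff) simp
    qed
  qed (use multiplicity_not_dvd[OF q] multiplicity_b_star[OF q] in simp)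
  thus "multiplicity q (t ^ n * b_star b t ^ k) \<le> multiplicity q (b ^ m)"
    using q b_ge t_ge b_star_pos
    by (simp add: prime_elem_multiplicity_power_distrib prime_elem_multiplicity_mult_distrib)
qed (use t_ge b_star_pos in simp)

end

section \<open>Hausdorff measure\<close>

lemma hausdorff_measure_eq_0I:
  assumes "\<And>\<delta> \<epsilon>. \<delta> > 0 \<Longrightarrow> \<epsilon> > 0 \<Longrightarrow>
    \<exists>U\<in>delta_covers \<delta> A. (\<Sum>i. diam_pow s (U i)) \<le> ennreal \<epsilon>"
  shows "hausdorff_measure s A = 0"
proof -
  have "hausdorff_pre s \<delta> A \<le> 0" if "\<delta> > 0" for \<delta>
  proof (rule ennreal_le_epsilon)
    fix e :: real assume "e > 0"
    then obtain U where U: "U \<in> delta_covers \<delta> A" "(\<Sum>i. diam_pow s (U i)) \<le> ennreal e"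
      using assms \<open>\<delta> > 0\<close> by blast
    have "hausdorff_pre s \<delta> A \<le> (\<Sum>i. diam_pow s (U i))"
      unfolding hausdorff_pre_def by (rule INF_lower[OF U(1)])
    thus "hausdorff_pre s \<delta> A \<le> 0 + ennreal e" using U(2) by simp
  qed
  thus ?thesis unfolding hausdorff_measure_def
    by (intro antisym SUP_least) auto
qed

text \<open>The Hausdorff form of the Borel-Cantelli lemma: the balls of index at least
  \<open>n0\<close> cover the limsup set for every \<open>n0\<close>, and their total cost is a tail
  of a convergent series.\<close>

lemma hausdorff_measure_limsup_balls:
  fixes C :: "nat \<Rightarrow> real set" and r :: "nat \<Rightarrow> real"
  assumes "s > 0" and fin: "\<And>n. finite (C n)" and pos: "\<And>n. r n \<ge> 0"
    and lim: "r \<longlonglongrightarrow> 0" and summ: "summable (\<lambda>n. real (card (C n)) * r n powr s)"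
    and A: "\<And>x. x \<in> A \<Longrightarrow> \<exists>\<^sub>\<infinity>n. \<exists>c\<in>C n. \<bar>x - c\<bar> \<le> r n"
  shows "hausdorff_measure s A = 0"
proof (rule hausdorff_measure_eq_0I)
  fix \<delta> \<epsilon> :: real assume \<delta>: "\<delta> > 0" and \<epsilon>: "\<epsilon> > 0"
  define a where "a n = 2 powr s * (real (card (C n)) * r n powr s)" for n
  have a0: "a n \<ge> 0" for n by (simp add: a_def)
  have suma: "summable a" unfolding a_def using summ by (rule summable_mult)
  have "eventually (\<lambda>n. r n < \<delta> / 2) sequentially" using lim \<delta> by (intro order_tendstoD(2)) auto
  then obtain n1 where n1: "\<And>n. n \<ge> n1 \<Longrightarrow> r n < \<delta> / 2" unfolding eventually_sequentially by blast
  have "(\<lambda>k. \<Sum>n. a (n + k)) \<longlonglongrightarrow> 0" by (rule suminf_exist_split2[OF suma])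
  hence "eventually (\<lambda>k. (\<Sum>n. a (n + k)) < \<epsilon>) sequentially" using \<epsilon> by (rule order_tendstoD(2))
  then obtain n2 where n2: "\<And>n. n \<ge> n2 \<Longrightarrow> (\<Sum>i. a (i + n)) < \<epsilon>"
    unfolding eventually_sequentially by blast
  define n0 where "n0 = max n1 n2"
  define h where "h n = to_nat_on (C n)" for n
  \<comment> \<open>Row \<open>n\<close> lists the balls of index \<open>n + n0\<close> and is
    padded with empty sets, which cost 0; \<open>prod_decode\<close> then turns the double family
    into one sequence.\<close>
  define V where "V = (\<lambda>(n, j). if j < card (C (n + n0))
     then {from_nat_into (C (n + n0)) j - r (n + n0) .. from_nat_into (C (n + n0)) j + r (n + n0)} else {})"
  define U where "U i = V (prod_decode i)" for i
  have V: "bounded (V p) \<and> diameter (V p) \<le> \<delta>" for p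
  proof -
    obtain n j where p: "p = (n, j)" by force
    have "2 * r (n + n0) \<le> \<delta>" using n1[of "n + n0"] unfolding n0_def by linarith
    thus ?thesis using \<delta> pos[of "n + n0"] by (auto simp: p V_def)
  qed
  have "A \<subseteq> (\<Union>i. U i)"
  proof
    fix x assume "x \<in> A"
    from A[OF this] obtain n c where n: "n \<ge> n0" "c \<in> C n" "\<bar>x - c\<bar> \<le> r n"
      unfolding INFM_nat_le by blast
    obtain j where j: "j < card (C n)" "from_nat_into (C n) j = c"
      using bij_betw_from_nat_into_finite[OF fin[of n]] n(2)
      by (metis bij_betw_imp_surj_on imageE lessThan_iff)
    have "x \<in> V (n - n0, j)" using n j by (auto simp: V_def)
    hence "x \<in> U (prod_encode (n - n0, j))" by (simp add: U_def)
    thus "x \<in> (\<Union>i. U i)" by blast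
  qed
  hence cov: "U \<in> delta_covers \<delta> A" using V unfolding delta_covers_def U_def by auto
  have inner: "(\<Sum>j. diam_pow s (V (n, j))) = ennreal (a (n + n0))" for n
  proof -
    have "(\<Sum>j. diam_pow s (V (n, j))) = (\<Sum>j<card (C (n + n0)). diam_pow s (V (n, j)))"
      by (rule suminf_finite) (auto simp: V_def diam_pow_def)
    also have "\<dots> = (\<Sum>j<card (C (n + n0)). ennreal ((2 * r (n + n0)) powr s))"
      using \<open>s > 0\<close> pos[of "n + n0"] by (intro sum.cong) (auto simp: V_def diam_pow_def)
    also have "\<dots> = ennreal (a (n + n0))"
      using pos[of "n + n0"] by (simp add: a_def powr_mult ennreal_mult' ennreal_of_nat_eq_real_of_nat mult_ac)
    finally show ?thesis .
  qed
  have "(\<Sum>i. diam_pow s (U i)) = (\<Sum>n. ennreal (a (n + n0)))"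
    unfolding U_def by (rule suminf_ennreal_2dimen[of _ "\<lambda>p. diam_pow s (V p)"]) (simp add: inner)
  also have "\<dots> = ennreal (\<Sum>n. a (n + n0))"
    using a0 suma by (intro suminf_ennreal2) (auto simp: summable_iff_shift)
  also have "\<dots> \<le> ennreal \<epsilon>" using n2[of n0] by (intro ennreal_leI) (auto simp: n0_def)
  finally show "\<exists>U\<in>delta_covers \<delta> A. (\<Sum>i. diam_pow s (U i)) \<le> ennreal \<epsilon>" using cov by blast
qed

text \<open>A hypothesis on intervals suffices, since a set of reals lies in an interval of equal diameter.\<close>

lemma mass_distribution_principle:
  fixes X :: "'a \<Rightarrow> real" and A :: "real set"
  assumes "prob_space M" and X: "X \<in> borel_measurable M" and "AE \<omega> in M. X \<omega> \<in> A"
    and "c > 0" and "s \<ge> 0"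
    and bound: "\<And>u v. u \<le> v \<Longrightarrow> v - u \<le> \<delta> \<Longrightarrow>
      emeasure M (X -` {u..v} \<inter> space M) \<le> ennreal c * diam_pow s {u..v}"
  shows "ennreal (1 / c) \<le> hausdorff_pre s \<delta> A"
  unfolding hausdorff_pre_def
proof (rule INF_greatest)
  interpret prob_space M by fact
  fix U assume "U \<in> delta_covers \<delta> A"
  hence U: "A \<subseteq> (\<Union>i. U i)" "\<And>i. bounded (U i)" "\<And>i. diameter (U i) \<le> \<delta>"
    unfolding delta_covers_def by auto
  \<comment> \<open>The sets of the cover need not be measurable, so each is replaced by the closed
    interval from its infimum to its supremum.\<close>
  have "\<exists>I. I \<in> sets borel \<and> U i \<subseteq> I \<and>
      emeasure M (X -` I \<inter> space M) \<le> ennreal c * diam_pow s (U i)" for i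
  proof (cases "U i = {}")
    case False
    have bdd: "bdd_above (U i)" "bdd_below (U i)"
      using U(2) by (auto intro: bounded_imp_bdd_above bounded_imp_bdd_below)
    have le: "Inf (U i) \<le> Sup (U i)" using False bdd by (intro cInf_le_cSup)
    have sub: "U i \<subseteq> {Inf (U i)..Sup (U i)}" using bdd by (auto intro: cInf_lower cSup_upper)
    have "Sup (U i) \<le> diameter (U i) + y" if "y \<in> U i" for y
      using diameter_bounded_bound[OF U(2) _ that] False
      by (intro cSup_least) (auto simp: dist_real_def abs_le_iff algebra_simps)
    hence "Sup (U i) - diameter (U i) \<le> Inf (U i)"
      using False by (intro cInf_greatest) (auto simp: algebra_simps)
    hence diam: "Sup (U i) - Inf (U i) \<le> diameter (U i)" by simp
    have "emeasure M (X -` {Inf (U i)..Sup (U i)} \<inter> space M)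
        \<le> ennreal c * diam_pow s {Inf (U i)..Sup (U i)}"
      using le diam U(3)[of i] by (intro bound) auto
    also have "\<dots> \<le> ennreal c * diam_pow s (U i)"
      using le diam False \<open>s \<ge> 0\<close>
      by (intro mult_left_mono) (auto simp: diam_pow_def intro!: ennreal_leI powr_mono2)
    finally show ?thesis using sub by (intro exI[of _ "{Inf (U i)..Sup (U i)}"]) auto
  qed (auto intro!: exI[of _ "{}"])
  then obtain I where I: "\<And>i. I i \<in> sets borel" "\<And>i. U i \<subseteq> I i"
      "\<And>i. emeasure M (X -` I i \<inter> space M) \<le> ennreal c * diam_pow s (U i)"
    by metis
  have meas: "X -` I i \<inter> space M \<in> sets M" for i using X I(1) by (rule measurable_sets)
  have "AE \<omega> in M. \<omega> \<in> (\<Union>i. X -` I i \<inter> space M)"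
    using assms(3) AE_space
  proof eventually_elim
    case (elim \<omega>)
    then obtain i where "X \<omega> \<in> U i" using U(1) by auto
    hence "X \<omega> \<in> I i" using I(2) by auto
    thus ?case using elim(2) by auto
  qed
  hence "1 = emeasure M (\<Union>i. X -` I i \<inter> space M)"
    using meas by (intro emeasure_eq_1_AE[symmetric] sets.countable_UN) (auto simp del: UN_iff)
  also have "\<dots> \<le> (\<Sum>i. emeasure M (X -` I i \<inter> space M))"
    using meas by (intro emeasure_subadditive_countably) auto
  also have "\<dots> \<le> (\<Sum>i. ennreal c * diam_pow s (U i))" using I(3) by (intro suminf_le) auto
  also have "\<dots> = ennreal c * (\<Sum>i. diam_pow s (U i))" by simp
  finally have "ennreal (1 / c) * 1 \<le> ennreal (1 / c) * (ennreal c * (\<Sum>i. diam_pow s (U i)))"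
    by (rule mult_left_mono) simp
  also have "\<dots> = (\<Sum>i. diam_pow s (U i))"
    using \<open>c > 0\<close> by (simp add: mult.assoc[symmetric] ennreal_mult'[symmetric])
  finally show "ennreal (1 / c) \<le> (\<Sum>i. diam_pow s (U i))" by simp
qed

section \<open>Random digit sequences\<close>

lemma measure_bind_pmf_le_sum:
  assumes "finite F" "set_pmf p \<subseteq> F" "\<And>n. n \<in> F \<Longrightarrow> measure_pmf.prob (K n) E \<le> h n"
  shows "measure_pmf.prob (bind_pmf p K) E \<le> (\<Sum>n\<in>F. pmf p n * h n)"
proof -
  have "ennreal (measure_pmf.prob (bind_pmf p K) E)
      = (\<integral>\<^sup>+n. ennreal (measure_pmf.prob (K n) E) \<partial>measure_pmf p)"
    by (simp add: measure_pmf.emeasure_eq_measure[symmetric])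
  also have "\<dots> = (\<Sum>n\<in>F. ennreal (measure_pmf.prob (K n) E) * ennreal (pmf p n))"
    using assms(1,2) by (intro nn_integral_measure_pmf_support) (auto simp: set_pmf_iff)
  also have "\<dots> = ennreal (\<Sum>n\<in>F. measure_pmf.prob (K n) E * pmf p n)"
    by (simp add: ennreal_mult'[symmetric] sum_ennreal)
  finally have "measure_pmf.prob (bind_pmf p K) E = (\<Sum>n\<in>F. measure_pmf.prob (K n) E * pmf p n)"
    by (subst (asm) ennreal_inj) (auto intro!: sum_nonneg)
  also have "\<dots> \<le> (\<Sum>n\<in>F. pmf p n * h n)"
    using assms(3) by (intro sum_mono) (subst mult.commute, rule mult_left_mono, auto)
  finally show ?thesis .
qed

text \<open>Independence gives one factor for each constrained position. The factor is 0 instead of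
  \<open>1 / card D\<close> if \<open>w i\<close> lies outside \<open>D\<close>, hence only an
  inequality.\<close>

lemma uniform_digits_prob_le:
  assumes "finite D" "D \<noteq> {}" "finite I" "J \<subseteq> I"
  shows "measure_pmf.prob (Pi_pmf I e (\<lambda>_. pmf_of_set D)) {f. \<forall>i\<in>J. f i = w i}
    \<le> (1 / real (card D)) ^ card J"
proof -
  have fJ: "finite J" using assms(3,4) finite_subset by blast
  let ?B = "\<lambda>i. if i \<in> J then {w i} else UNIV"
  have "measure_pmf.prob (Pi_pmf I e (\<lambda>_. pmf_of_set D)) {f. \<forall>i\<in>J. f i = w i}
      \<le> measure_pmf.prob (Pi_pmf I e (\<lambda>_. pmf_of_set D)) (Pi I ?B)"
    using assms(4) by (intro measure_pmf.finite_measure_mono) auto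
  also have "\<dots> = (\<Prod>i\<in>I. measure_pmf.prob (pmf_of_set D) (?B i))"
    by (rule measure_Pi_pmf_Pi[OF assms(3)])
  also have "\<dots> = (\<Prod>i\<in>J. measure_pmf.prob (pmf_of_set D) (?B i))"
    using assms(3,4) by (intro prod.mono_neutral_right) auto
  also have "\<dots> \<le> (\<Prod>i\<in>J. 1 / real (card D))"
    using assms(1,2)
    by (intro prod_mono) (auto simp: measure_pmf_single indicator_def)
  finally show ?thesis by simp
qed

lemma exists_pmf_with_weights:
  fixes c :: "nat \<Rightarrow> real"
  assumes "finite F" "\<And>n. n \<in> F \<Longrightarrow> c n \<ge> 0" "sum c F = 1"
  obtains p where "set_pmf p \<subseteq> F" "\<And>n. n \<in> F \<Longrightarrow> pmf p n = c n"
proof -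
  define f where "f n = (if n \<in> F then c n else 0)" for n
  have f0: "f n \<ge> 0" for n using assms(2) by (simp add: f_def)
  have "(\<integral>\<^sup>+n. ennreal (f n) \<partial>count_space UNIV) = (\<Sum>n\<in>F. ennreal (f n))"
    using assms(1) by (intro nn_integral_count_space') (auto simp: f_def)
  also have "\<dots> = ennreal (sum c F)" using assms(2) by (subst sum_ennreal) (auto simp: f_def)
  finally have one: "(\<integral>\<^sup>+n. ennreal (f n) \<partial>count_space UNIV) = 1" using assms(3) by simp
  have pf: "pmf (embed_pmf f) n = f n" for n using f0 one by (rule pmf_embed_pmf)
  show ?thesis
    by (rule that[of "embed_pmf f"]) (auto simp: pf f_def set_pmf_iff split: if_splits)
qed

text \<open>The random block: draw \<open>n\<close> with probability \<open>c n\<close>, take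
  uniform digits on \<open>{S..<T}\<close> and overwrite \<open>{l n..<m n}\<close> by
  \<open>e\<close>. Only positions outside the run cost a factor \<open>q\<close>. The two summands
  of the bound correspond to prefixes that end before the run and prefixes that reach into it or
  beyond.\<close>

lemma stage_pmf:
  fixes l m :: "nat \<Rightarrow> nat" and c :: "nat \<Rightarrow> real" and D :: "nat set"
  assumes D: "finite D" "e \<in> D" and F: "finite F"
    and c: "\<And>n. n \<in> F \<Longrightarrow> c n \<ge> 0" "sum c F = 1"
    and lm: "\<And>n. n \<in> F \<Longrightarrow> S \<le> l n \<and> l n \<le> m n \<and> m n \<le> T"
  defines "q \<equiv> 1 / real (card D)"
  obtains B where
    "\<And>f i. f \<in> set_pmf B \<Longrightarrow> f i \<in> D"
    "\<And>f. f \<in> set_pmf B \<Longrightarrow> \<exists>n\<in>F. \<forall>i\<in>{l n..<m n}. f i = e"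
    "\<And>w k. S \<le> k \<Longrightarrow> k \<le> T \<Longrightarrow> measure_pmf.prob B {f. \<forall>i\<in>{S..<k}. f i = w i}
      \<le> q ^ (k - S) + (\<Sum>n\<in>F. c n * q ^ (l n + (k - m n))) / q ^ S"
proof -
  have N: "card D > 0" using D by (auto simp: card_gt_0_iff)
  hence q: "q > 0" unfolding q_def by simp
  obtain p where p: "set_pmf p \<subseteq> F" "\<And>n. n \<in> F \<Longrightarrow> pmf p n = c n"
    using exists_pmf_with_weights[OF F c] by blast
  define G where "G = Pi_pmf {S..<T} e (\<lambda>_. pmf_of_set D)"
  define ov where "ov n f i = (if i \<in> {l n..<m n} then e else f i)" for n and f :: "nat \<Rightarrow> nat" and i
  define B where "B = bind_pmf p (\<lambda>n. map_pmf (ov n) G)"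
  have G: "f i \<in> D" if "f \<in> set_pmf G" for f i
  proof -
    have "set_pmf (pmf_of_set D) = D" using D by (intro set_pmf_of_set) auto
    thus ?thesis using that D(2) unfolding G_def
      by (cases "i \<in> {S..<T}") (auto simp: set_Pi_pmf PiE_dflt_def)
  qed
  have B: "\<exists>n\<in>F. \<exists>g\<in>set_pmf G. f = ov n g" if "f \<in> set_pmf B" for f
    using that p(1) unfolding B_def by auto
  show ?thesis
  proof (rule that[of B])
    show "f i \<in> D" if "f \<in> set_pmf B" for f i
      using B[OF that] G D(2) by (auto simp: ov_def)
    show "\<exists>n\<in>F. \<forall>i\<in>{l n..<m n}. f i = e" if "f \<in> set_pmf B" for f
      using B[OF that] by (force simp: ov_def)
    fix w :: "nat \<Rightarrow> nat" and k assume k: "S \<le> k" "k \<le> T"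
    let ?E = "{f. \<forall>i\<in>{S..<k}. f i = w i}"
    have each: "measure_pmf.prob (map_pmf (ov n) G) ?E \<le> q ^ (k - S) + q ^ (l n + (k - m n)) / q ^ S"
      if n: "n \<in> F" for n
    proof -
      \<comment> \<open>The positions below \<open>k\<close> whose digits are still uniform.\<close>
      define J where "J = {S..<k} - {l n..<m n}"
      have "measure_pmf.prob (map_pmf (ov n) G) ?E = measure_pmf.prob G (ov n -` ?E)" by simp
      also have "\<dots> \<le> measure_pmf.prob G {f. \<forall>i\<in>J. f i = w i}"
      proof (rule measure_pmf.finite_measure_mono)
        have ov: "ov n f i = f i" if "i \<in> J" for f i using that by (auto simp: ov_def J_def)
        have J: "i \<in> {S..<k}" if "i \<in> J" for i using that by (simp add: J_def)
        show "ov n -` ?E \<subseteq> {f. \<forall>i\<in>J. f i = w i}"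
        proof (intro subsetI CollectI ballI)
          fix f i assume f: "f \<in> ov n -` ?E" and i: "i \<in> J"
          from f have "\<forall>i\<in>{S..<k}. ov n f i = w i" by (simp only: vimage_def mem_Collect_eq)
          hence "ov n f i = w i" using J[OF i] by (rule bspec)
          thus "f i = w i" by (simp only: ov[OF i])
        qed
      qed simp
      also have "\<dots> \<le> q ^ card J"
        unfolding G_def q_def using D k by (intro uniform_digits_prob_le) (auto simp: J_def)
      also have "q ^ card J \<le> q ^ (k - S) + q ^ (l n + (k - m n)) / q ^ S"
      proof (cases "k \<le> l n")
        case True
        hence "J = {S..<k}" by (auto simp: J_def)
        thus ?thesis using q by simp
      next
        case False
        \<comment> \<open>If \<open>k\<close> lies inside the run, the second set is empty; this
          agrees with the truncated subtraction \<open>k - m n\<close> in the bound.\<close>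
        have "card J = card {S..<l n} + card {m n..<k}"
          using False lm[OF n] by (subst card_Un_disjoint[symmetric]) (auto simp: J_def intro!: arg_cong[where f = card])
        hence "card J + S = l n + (k - m n)" using lm[OF n] by simp
        hence "q ^ (l n + (k - m n)) = q ^ card J * q ^ S" by (metis power_add)
        thus ?thesis using q by simp
      qed
      finally show ?thesis .
    qed
    have "measure_pmf.prob B ?E \<le> (\<Sum>n\<in>F. pmf p n * (q ^ (k - S) + q ^ (l n + (k - m n)) / q ^ S))"
      unfolding B_def by (rule measure_bind_pmf_le_sum[OF F p(1) each])
    also have "\<dots> = (\<Sum>n\<in>F. c n * q ^ (k - S) + c n * q ^ (l n + (k - m n)) / q ^ S)"
      using p(2) by (intro sum.cong) (auto simp: algebra_simps)
    also have "\<dots> = q ^ (k - S) + (\<Sum>n\<in>F. c n * q ^ (l n + (k - m n))) / q ^ S"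
      using c(2) by (simp add: sum.distrib sum_distrib_right[symmetric] sum_divide_distrib[symmetric])
    finally show "measure_pmf.prob B ?E
      \<le> q ^ (k - S) + (\<Sum>n\<in>F. c n * q ^ (l n + (k - m n))) / q ^ S" .
  qed
qed

section \<open>Concatenation of independent blocks\<close>

definition block_index :: "(nat \<Rightarrow> nat) \<Rightarrow> nat \<Rightarrow> nat" where
  "block_index S i = (LEAST j. i < S (Suc j))"

lemma block_index_eq:
  assumes "strict_mono S" "S j \<le> i" "i < S (Suc j)"
  shows "block_index S i = j"
  unfolding block_index_def
proof (rule Least_equality)
  show "j \<le> j'" if "i < S (Suc j')" for j'
  proof (rule ccontr)
    assume "\<not> j \<le> j'"
    hence "S (Suc j') \<le> S j" using assms(1) by (simp add: strict_mono_less_eq)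
    thus False using that assms(2) by simp
  qed
qed fact

text \<open>Every coordinate of the product space is a whole digit sequence, of which only the
  digits in its own block are read. A condition on the first \<open>k\<close> digits thus splits
  into independent conditions on the blocks up to \<open>J\<close>, the last one cut off at
  \<open>k\<close>.\<close>

lemma block_prefix_prob_le:
  fixes B :: "nat \<Rightarrow> (nat \<Rightarrow> nat) pmf"
  assumes S: "strict_mono S" and k: "S J \<le> k" "k \<le> S (Suc J)"
  defines "M \<equiv> PiM UNIV (\<lambda>j. measure_pmf (B j))"
  shows "emeasure M {\<omega> \<in> space M. \<forall>i<k. \<omega> (block_index S i) i = w i}
    \<le> ennreal ((\<Prod>j<J. measure_pmf.prob (B j) {f. \<forall>i\<in>{S j..<S (Suc j)}. f i = w i})
        * measure_pmf.prob (B J) {f. \<forall>i\<in>{S J..<k}. f i = w i})"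
proof -
  let ?R = "\<lambda>j. if j = J then {f. \<forall>i\<in>{S J..<k}. f i = w i} else {f. \<forall>i\<in>{S j..<S (Suc j)}. f i = w i}"
  let ?E = "prod_emb UNIV (\<lambda>j. measure_pmf (B j)) {..J} (Pi\<^sub>E {..J} ?R)"
  have "\<omega> j \<in> ?R j" if \<omega>: "\<forall>i<k. \<omega> (block_index S i) i = w i" and j: "j \<le> J" for \<omega> j
  proof (cases "j = J")
    case True
    thus ?thesis using \<omega> block_index_eq[OF S, of J] k by auto
  next
    case False
    hence "S (Suc j) \<le> S J" using S j by (simp add: strict_mono_less_eq)
    hence "\<omega> j i = w i" if "i \<in> {S j..<S (Suc j)}" for i
      using \<omega>[rule_format, of i] block_index_eq[OF S, of j i] that k by simp
    thus ?thesis using False by simp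
  qed
  hence "{\<omega> \<in> space M. \<forall>i<k. \<omega> (block_index S i) i = w i} \<subseteq> ?E"
    by (auto simp: prod_emb_def M_def space_PiM PiE_iff)
  moreover have "?E \<in> sets M" unfolding M_def by (intro sets_PiM_I) auto
  ultimately have "emeasure M {\<omega> \<in> space M. \<forall>i<k. \<omega> (block_index S i) i = w i} \<le> emeasure M ?E"
    by (rule emeasure_mono)
  also have "\<dots> = (\<Prod>j\<in>{..J}. emeasure (measure_pmf (B j)) (?R j))"
    unfolding M_def by (intro emeasure_PiM_emb) (auto intro: measure_pmf.prob_space_axioms)
  also have "\<dots> = ennreal (\<Prod>j\<in>{..J}. measure_pmf.prob (B j) (?R j))"
    by (simp add: measure_pmf.emeasure_eq_measure prod_ennreal)
  also have "{..J} = insert J {..<J}" by auto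
  also have "(\<Prod>j\<in>insert J {..<J}. measure_pmf.prob (B j) (?R j))
      = (\<Prod>j<J. measure_pmf.prob (B j) {f. \<forall>i\<in>{S j..<S (Suc j)}. f i = w i})
        * measure_pmf.prob (B J) {f. \<forall>i\<in>{S J..<k}. f i = w i}"
    by (subst prod.insert) (auto simp: mult.commute intro!: prod.cong)
  finally show ?thesis .
qed

lemma strict_mono_interval:
  fixes S :: "nat \<Rightarrow> nat"
  assumes "strict_mono S" "S 1 \<le> k"
  obtains j where "j \<ge> 1" "S j \<le> k" "k \<le> S (Suc j)"
proof -
  define j where "j = (GREATEST j. S j \<le> k)"
  have bd: "\<And>i. S i \<le> k \<Longrightarrow> i \<le> k" using seq_suble[OF assms(1)] le_trans by blast
  have "S j \<le> k" unfolding j_def by (rule GreatestI_nat[of _ 1 k]) (use assms bd in auto)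
  moreover have "1 \<le> j" unfolding j_def by (rule Greatest_le_nat[of _ _ k]) (use assms bd in auto)
  moreover have "\<not> S (Suc j) \<le> k"
  proof
    assume "S (Suc j) \<le> k"
    hence "Suc j \<le> j" unfolding j_def by (intro Greatest_le_nat[of _ _ k]) (use bd in auto)
    thus False by simp
  qed
  ultimately show ?thesis using that by simp
qed

text \<open>
  The error term of a single block is \<open>\<epsilon> / 4 * \<sigma> ^ k\<close>; the main term \<open>q ^ (k - S j)\<close> decays faster
  than \<open>\<sigma> ^ (k - S j)\<close>, which is what absorbs the error of the preceding blocks.
\<close>

lemma block_product_bound:
  fixes p :: "nat \<Rightarrow> real" and S :: "nat \<Rightarrow> nat"
  assumes S: "strict_mono S" "S 0 = 0" and eps: "0 < \<epsilon>" "\<epsilon> \<le> 1" and qs: "0 < q" "q \<le> \<sigma>"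
    and p: "\<And>j. 0 \<le> p j" "\<And>j. p j \<le> 1"
      "\<And>j. p j \<le> q ^ (S (Suc j) - S j) + \<epsilon> / 4 * \<sigma> ^ S (Suc j)"
    and gap: "\<And>j. q ^ (S (Suc j) - S j) \<le> \<epsilon> / 4 * \<sigma> ^ (S (Suc j) - S j)"
    and "j \<ge> 1"
  shows "(\<Prod>i<j. p i) \<le> \<epsilon> / 2 * \<sigma> ^ S j"
  using \<open>j \<ge> 1\<close>
proof (induction j rule: dec_induct)
  case base
  show ?case using p(3)[of 0] gap[of 0] S(2) by simp
next
  case (step j)
  have sig: "\<sigma> > 0" using qs by simp
  have P: "0 \<le> (\<Prod>i<j. p i)" "(\<Prod>i<j. p i) \<le> 1"
    using p(1,2) by (auto intro: prod_nonneg prod_le_1)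
  have split: "\<sigma> ^ S (Suc j) = \<sigma> ^ S j * \<sigma> ^ (S (Suc j) - S j)"
    using S(1) by (simp add: power_add[symmetric] strict_mono_less_eq)
  have "(\<Prod>i<Suc j. p i) \<le> (\<Prod>i<j. p i) * (q ^ (S (Suc j) - S j) + \<epsilon> / 4 * \<sigma> ^ S (Suc j))"
    using P p(3)[of j] by (simp add: mult_left_mono)
  also have "\<dots> = (\<Prod>i<j. p i) * q ^ (S (Suc j) - S j) + (\<Prod>i<j. p i) * (\<epsilon> / 4 * \<sigma> ^ S (Suc j))"
    by (simp add: distrib_left)
  \<comment> \<open>The induction hypothesis is spent on the main term only; for the error term it
    is enough that the product is at most 1. Each of the two parts ends up at most \<epsilon>/4
    times \<open>\<sigma> ^ S (Suc j)\<close>.\<close>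
  also have "\<dots> \<le> (\<epsilon> / 2 * \<sigma> ^ S j) * (\<epsilon> / 4 * \<sigma> ^ (S (Suc j) - S j)) + 1 * (\<epsilon> / 4 * \<sigma> ^ S (Suc j))"
    using P step.IH gap[of j] eps sig qs by (intro add_mono mult_mono) auto
  also have "\<dots> = (\<epsilon> / 2) * (\<epsilon> / 4 * \<sigma> ^ S (Suc j)) + \<epsilon> / 4 * \<sigma> ^ S (Suc j)"
    unfolding split by (simp add: mult_ac)
  also have "\<dots> \<le> 1 * (\<epsilon> / 4 * \<sigma> ^ S (Suc j)) + \<epsilon> / 4 * \<sigma> ^ S (Suc j)"
    using eps sig by (intro add_mono mult_right_mono) auto
  finally show ?case by simp
qed

text \<open>Blocks are chosen recursively: \<open>P S T B\<close> records what a block law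
  \<open>B\<close> on \<open>{S..<T}\<close> must satisfy, and such \<open>T\<close> and
  \<open>B\<close> exist for every start \<open>S\<close>. The product of the block laws then plants
  runs arbitrarily far out while cylinders keep small mass.\<close>

lemma exists_digit_measure:
  fixes l m :: "nat \<Rightarrow> nat" and D :: "nat set"
  assumes D: "finite D" "e \<in> D" and eps: "0 < \<epsilon>" "\<epsilon> \<le> 1" and qs: "1 / real (card D) < \<sigma>"
    and weights: "\<And>S \<kappa>. \<kappa> > 0 \<Longrightarrow> \<exists>F c. finite F \<and> (\<forall>n\<in>F. c n \<ge> 0 \<and> S \<le> l n \<and> l n \<le> m n) \<and>
      sum c F = 1 \<and> (\<forall>k. (\<Sum>n\<in>F. c n * (1 / real (card D)) ^ (l n + (k - m n))) \<le> \<kappa> * \<sigma> ^ k)"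
  obtains M :: "(nat \<Rightarrow> nat \<Rightarrow> nat) measure" and dig k0 where
    "prob_space M" "\<And>i. (\<lambda>\<omega>. dig \<omega> i) \<in> measurable M (count_space UNIV)"
    "AE \<omega> in M. (\<forall>i. dig \<omega> i \<in> D) \<and> (\<forall>S. \<exists>n. S \<le> l n \<and> (\<forall>i\<in>{l n..<m n}. dig \<omega> i = e))"
    "\<And>w k. k \<ge> k0 \<Longrightarrow> emeasure M {\<omega> \<in> space M. \<forall>i<k. dig \<omega> i = w i} \<le> ennreal (\<epsilon> * \<sigma> ^ k)"
proof -
  define q where "q = 1 / real (card D)"
  have "card D > 0" using D by (auto simp: card_gt_0_iff)
  hence q: "0 < q" "q < \<sigma>" using qs unfolding q_def by simp_all
  define P where "P S T B \<longleftrightarrow> S < T \<and>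
     (\<forall>f\<in>set_pmf B. (\<forall>i. f i \<in> D) \<and>
        (\<exists>n. S \<le> l n \<and> l n \<le> m n \<and> m n \<le> T \<and> (\<forall>i\<in>{l n..<m n}. f i = e))) \<and>
     (\<forall>w k. S \<le> k \<longrightarrow> k \<le> T \<longrightarrow> measure_pmf.prob B {f. \<forall>i\<in>{S..<k}. f i = w i}
        \<le> q ^ (k - S) + \<epsilon> / 4 * \<sigma> ^ k) \<and>
     q ^ (T - S) \<le> \<epsilon> / 4 * \<sigma> ^ (T - S)" for S T and B :: "(nat \<Rightarrow> nat) pmf"
  have "\<exists>T B. P S T B" for S
  proof -
    \<comment> \<open>This is the value of \<kappa>; its factor \<open>q ^ S\<close> cancels the
      division by \<open>q ^ S\<close> in the bound for a block.\<close>
    have "\<epsilon> / 4 * q ^ S > 0" using eps q by simp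
    from weights[OF this, folded q_def, of S] obtain F c where F: "finite F"
      "\<And>n. n \<in> F \<Longrightarrow> c n \<ge> 0" "\<And>n. n \<in> F \<Longrightarrow> S \<le> l n" "\<And>n. n \<in> F \<Longrightarrow> l n \<le> m n"
      "sum c F = 1"
      "\<And>k. (\<Sum>n\<in>F. c n * q ^ (l n + (k - m n))) \<le> \<epsilon> / 4 * q ^ S * \<sigma> ^ k"
      by blast
    obtain T0 where T0: "(q / \<sigma>) ^ T0 < \<epsilon> / 4"
      using real_arch_pow_inv[of "\<epsilon> / 4" "q / \<sigma>"] q eps by auto
    \<comment> \<open>Large enough to contain every possible run, and at least \<open>T0\<close>
      longer than \<open>S\<close>, so that the main term at the end of the block is beaten by
      \<epsilon>/4.\<close>
    define T where "T = S + T0 + 1 + (\<Sum>n\<in>F. m n)"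
    have mT: "m n \<le> T" if "n \<in> F" for n
      using member_le_sum[of n F m] that F(1) by (simp add: T_def)
    obtain B where B: "\<And>f i. f \<in> set_pmf B \<Longrightarrow> f i \<in> D"
      "\<And>f. f \<in> set_pmf B \<Longrightarrow> \<exists>n\<in>F. \<forall>i\<in>{l n..<m n}. f i = e"
      "\<And>w k. S \<le> k \<Longrightarrow> k \<le> T \<Longrightarrow> measure_pmf.prob B {f. \<forall>i\<in>{S..<k}. f i = w i}
        \<le> q ^ (k - S) + (\<Sum>n\<in>F. c n * q ^ (l n + (k - m n))) / q ^ S"
      by (rule stage_pmf[OF D F(1,2,5), of S l m T, folded q_def]) (use F(3,4) mT in auto)
    have "measure_pmf.prob B {f. \<forall>i\<in>{S..<k}. f i = w i} \<le> q ^ (k - S) + \<epsilon> / 4 * \<sigma> ^ k"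
      if "S \<le> k" "k \<le> T" for w k
    proof -
      have "(\<Sum>n\<in>F. c n * q ^ (l n + (k - m n))) / q ^ S \<le> \<epsilon> / 4 * \<sigma> ^ k"
        using F(6)[of k] q by (simp add: field_simps)
      thus ?thesis using B(3)[OF that, of w] by linarith
    qed
    moreover have "q ^ (T - S) \<le> \<epsilon> / 4 * \<sigma> ^ (T - S)"
    proof -
      have "(q / \<sigma>) ^ (T - S) \<le> (q / \<sigma>) ^ T0"
        using q by (intro power_decreasing) (auto simp: T_def)
      hence "(q / \<sigma>) ^ (T - S) \<le> \<epsilon> / 4" using T0 by simp
      thus ?thesis using q by (simp add: power_divide field_simps)
    qed
    moreover have "\<exists>n. S \<le> l n \<and> l n \<le> m n \<and> m n \<le> T \<and> (\<forall>i\<in>{l n..<m n}. f i = e)"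
      if "f \<in> set_pmf B" for f
      using B(2)[OF that] F(3,4) mT by blast
    ultimately have "P S T B" unfolding P_def using B(1) by (simp add: T_def)
    thus ?thesis by blast
  qed
  then obtain Tf Bf where TB: "\<And>S. P S (Tf S) (Bf S)" by metis
  define S where "S j = (Tf ^^ j) 0" for j
  define B where "B j = Bf (S j)" for j
  have P: "P (S j) (S (Suc j)) (B j)" for j using TB[of "S j"] by (simp add: S_def B_def)
  have S: "strict_mono S" using P unfolding P_def by (simp add: strict_mono_Suc_iff)
  have S0: "S 0 = 0" by (simp add: S_def)
  define M where "M = PiM UNIV (\<lambda>j. measure_pmf (B j))"
  define dig where "dig \<omega> i = \<omega> (block_index S i) i" for \<omega> :: "nat \<Rightarrow> nat \<Rightarrow> nat" and i
  have M: "prob_space M" unfolding M_def by (intro prob_space_PiM measure_pmf.prob_space_axioms)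
  show ?thesis
  \<comment> \<open>The threshold is the end of the first block: inside that block no completed
    block is available to supply a small factor.\<close>
  proof (rule that[of M dig "S 1"])
    show "prob_space M" by fact
    show "(\<lambda>\<omega>. dig \<omega> i) \<in> measurable M (count_space UNIV)" for i
      unfolding M_def dig_def
      by (rule measurable_compose[OF measurable_component_singleton]) auto
    have "AE \<omega> in M. \<forall>j. \<omega> j \<in> set_pmf (B j)"
      unfolding M_def AE_all_countable
      by (intro allI AE_PiM_component) (auto intro: measure_pmf.prob_space_axioms simp: AE_measure_pmf)
    thus "AE \<omega> in M. (\<forall>i. dig \<omega> i \<in> D) \<and> (\<forall>S. \<exists>n. S \<le> l n \<and> (\<forall>i\<in>{l n..<m n}. dig \<omega> i = e))"
    proof eventually_elim
      case (elim \<omega>)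
      have "\<exists>n. s \<le> l n \<and> (\<forall>i\<in>{l n..<m n}. dig \<omega> i = e)" for s
      proof -
        obtain n where n: "S s \<le> l n" "l n \<le> m n" "m n \<le> S (Suc s)" "\<forall>i\<in>{l n..<m n}. \<omega> s i = e"
          using P[of s] elim unfolding P_def by blast
        have "block_index S i = s" if "i \<in> {l n..<m n}" for i
          using that n by (intro block_index_eq[OF S]) auto
        moreover have "s \<le> l n" using seq_suble[OF S, of s] n(1) by simp
        ultimately show ?thesis using n(4) by (auto simp: dig_def)
      qed
      moreover have "dig \<omega> i \<in> D" for i using P elim unfolding P_def dig_def by blast
      ultimately show ?case by blast
    qed
    fix w k assume "S 1 \<le> k"
    then obtain j where j: "j \<ge> 1" "S j \<le> k" "k \<le> S (Suc j)" using strict_mono_interval[OF S] by blast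
    define p where "p j = measure_pmf.prob (B j) {f. \<forall>i\<in>{S j..<S (Suc j)}. f i = w i}" for j
    define p' where "p' = measure_pmf.prob (B j) {f. \<forall>i\<in>{S j..<k}. f i = w i}"
    have Sle: "S j \<le> S (Suc j)" for j using S by (simp add: strict_mono_less_eq)
    have prod: "(\<Prod>i<j. p i) \<le> \<epsilon> / 2 * \<sigma> ^ S j"
      using P Sle q j(1) unfolding P_def
      by (intro block_product_bound[OF S S0 eps q(1)]) (auto simp: p_def)
    have p': "p' \<le> q ^ (k - S j) + \<epsilon> / 4 * \<sigma> ^ k"
      using P[of j] j unfolding P_def p'_def by blast
    have P1: "0 \<le> (\<Prod>i<j. p i)" "(\<Prod>i<j. p i) \<le> 1"
      by (auto intro: prod_nonneg prod_le_1 simp: p_def)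
    have "(\<Prod>i<j. p i) * p' \<le> (\<Prod>i<j. p i) * (q ^ (k - S j) + \<epsilon> / 4 * \<sigma> ^ k)"
      using p' P1 by (simp add: mult_left_mono)
    also have "\<dots> = (\<Prod>i<j. p i) * q ^ (k - S j) + (\<Prod>i<j. p i) * (\<epsilon> / 4 * \<sigma> ^ k)"
      by (simp add: distrib_left)
    \<comment> \<open>Completed blocks give \<epsilon>/2 times \<open>\<sigma> ^ S j\<close>, and in
      the current block \<open>q ^ (k - S j)\<close> is at most
      \<open>\<sigma> ^ (k - S j)\<close>.\<close>
    also have "\<dots> \<le> (\<epsilon> / 2 * \<sigma> ^ S j) * \<sigma> ^ (k - S j) + 1 * (\<epsilon> / 4 * \<sigma> ^ k)"
      using prod P1 eps q by (intro add_mono mult_mono power_mono) auto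
    also have "\<dots> = \<epsilon> / 2 * \<sigma> ^ k + \<epsilon> / 4 * \<sigma> ^ k"
      using j(2) by (simp add: mult.assoc power_add[symmetric])
    also have "\<dots> \<le> \<epsilon> * \<sigma> ^ k" using eps q by simp
    finally show "emeasure M {\<omega> \<in> space M. \<forall>i<k. dig \<omega> i = w i} \<le> ennreal (\<epsilon> * \<sigma> ^ k)"
      using block_prefix_prob_le[OF S j(2,3), of B w] unfolding M_def[symmetric] dig_def p_def p'_def
      by (meson ennreal_leI order_trans)
  qed
qed

section \<open>From the mass of cylinders to Hausdorff measure\<close>

text \<open>An interval shorter than \<open>b ^ - k\<close> only meets expansions with one of two
  consecutive prefix values of length \<open>k\<close>, which accounts for the factor 2.\<close>

lemma digit_interval_bound:
  fixes M :: "'a measure"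
  assumes "prob_space M" and meas: "\<And>i. (\<lambda>\<omega>. dig \<omega> i) \<in> measurable M (count_space UNIV)"
    and AE: "AE \<omega> in M. \<forall>i. dig \<omega> i < b" and b: "b \<ge> 2"
    and cyl: "\<And>w. emeasure M {\<omega> \<in> space M. \<forall>i<k. dig \<omega> i = w i} \<le> ennreal \<eta>"
    and uv: "v - u < 1 / real b ^ k" and "\<eta> \<ge> 0"
  shows "emeasure M ((\<lambda>\<omega>. \<Sum>i. real (dig \<omega> i) / real b ^ Suc i) -` {u..v} \<inter> space M)
    \<le> ennreal (2 * \<eta>)"
proof -
  interpret prob_space M by fact
  define X where "X \<omega> = (\<Sum>i. real (dig \<omega> i) / real b ^ Suc i)" for \<omega>
  define E where "E a = {\<omega> \<in> space M. int (prefix_val b (dig \<omega>) k) = a}" for a :: int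
  have [measurable]: "(\<lambda>\<omega>. dig \<omega> i) \<in> measurable M (count_space UNIV)" for i by (rule meas)
  have "(\<lambda>\<omega>. prefix_val b (dig \<omega>) k) \<in> measurable M (count_space UNIV)"
    by (induction k) simp_all
  hence E[measurable]: "E a \<in> sets M" for a unfolding E_def by measurable
  have Ele: "emeasure M (E a) \<le> ennreal \<eta>" for a
  proof (cases "\<exists>w. (\<forall>i. w i < b) \<and> int (prefix_val b w k) = a")
    case True
    then obtain w where w: "\<And>i. w i < b" "int (prefix_val b w k) = a" by blast
    have "emeasure M (E a) \<le> emeasure M {\<omega> \<in> space M. \<forall>i<k. dig \<omega> i = w i}"
    proof (rule emeasure_mono_AE)
      show "AE \<omega> in M. \<omega> \<in> E a \<longrightarrow> \<omega> \<in> {\<omega> \<in> space M. \<forall>i<k. dig \<omega> i = w i}"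
        using AE
      proof eventually_elim
        case (elim \<omega>)
        show ?case
        proof
          assume "\<omega> \<in> E a"
          hence "\<omega> \<in> space M" "prefix_val b (dig \<omega>) k = prefix_val b w k"
            using w(2) unfolding E_def by auto
          thus "\<omega> \<in> {\<omega> \<in> space M. \<forall>i<k. dig \<omega> i = w i}"
            using prefix_val_inj[of "dig \<omega>" b w k] elim w(1) by simp
        qed
      qed
      show "{\<omega> \<in> space M. \<forall>i<k. dig \<omega> i = w i} \<in> sets M" by measurable
    qed
    thus ?thesis using cyl[of w] by (rule order_trans)
  next
    \<comment> \<open>Here \<open>a\<close> is not the value of any string of \<open>k\<close>
      digits below \<open>b\<close>, so \<open>E a\<close> is a null set.\<close>
    case False
    have "emeasure M (E a) \<le> emeasure M {}"
    proof (rule emeasure_mono_AE)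
      show "AE \<omega> in M. \<omega> \<in> E a \<longrightarrow> \<omega> \<in> {}"
        using AE
      proof eventually_elim
        case (elim \<omega>)
        thus ?case using False unfolding E_def by blast
      qed
    qed simp
    thus ?thesis by simp
  qed
  \<comment> \<open>The prefix value lies in the half-open interval from
    \<open>b ^ k * u - 1\<close> to \<open>b ^ k * u + 1\<close>, whose only integers are
    \<open>z\<close> and \<open>z + 1\<close>.\<close>
  define z where "z = \<lceil>real b ^ k * u\<rceil> - 1"
  have "emeasure M (X -` {u..v} \<inter> space M) \<le> emeasure M (E z \<union> E (z + 1))"
  proof (rule emeasure_mono_AE)
    show "AE \<omega> in M. \<omega> \<in> X -` {u..v} \<inter> space M \<longrightarrow> \<omega> \<in> E z \<union> E (z + 1)"
      using AE
    proof eventually_elim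
      case (elim \<omega>)
      show ?case
      proof
        assume \<omega>: "\<omega> \<in> X -` {u..v} \<inter> space M"
        have sums: "(\<lambda>i. real (dig \<omega> i) / real b ^ Suc i) sums X \<omega>"
          unfolding X_def using elim b by (intro summable_sums summable_digits) auto
        have bk: "real b ^ k > 0" using b by simp
        have lo: "real b ^ k * u - 1 \<le> real (prefix_val b (dig \<omega>) k)"
          using digits_sums_bounds(2)[of "dig \<omega>" b "X \<omega>" k] elim sums \<omega>
            mult_left_mono[of u "X \<omega>" "real b ^ k", OF _ less_imp_le[OF bk]] by simp
        have "real (prefix_val b (dig \<omega>) k) \<le> real b ^ k * v"
          using digits_sums_bounds(1)[of "dig \<omega>" b "X \<omega>" k] elim sums \<omega>
            mult_left_mono[of "X \<omega>" v "real b ^ k", OF _ less_imp_le[OF bk]] by simp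
        also have "\<dots> < real b ^ k * u + 1" using uv bk by (simp add: field_simps)
        finally have hi: "real (prefix_val b (dig \<omega>) k) < real b ^ k * u + 1" .
        have "int (prefix_val b (dig \<omega>) k) = z \<or> int (prefix_val b (dig \<omega>) k) = z + 1"
          using lo hi unfolding z_def by linarith
        thus "\<omega> \<in> E z \<union> E (z + 1)" using \<omega> unfolding E_def by auto
      qed
    qed
  qed measurable
  also have "\<dots> \<le> emeasure M (E z) + emeasure M (E (z + 1))"
    by (rule emeasure_subadditive) measurable
  also have "\<dots> \<le> ennreal \<eta> + ennreal \<eta>" by (intro add_mono Ele)
  also have "\<dots> = ennreal (2 * \<eta>)" using \<open>\<eta> \<ge> 0\<close> by (simp add: ennreal_plus[symmetric] del: ennreal_plus)
  finally show ?thesis unfolding X_def .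
qed

lemma power_scale_exists:
  fixes \<rho> :: real and b k0 :: nat
  assumes "b \<ge> 2" "0 < \<rho>" "\<rho> < 1 / real b ^ k0"
  obtains k where "k \<ge> k0" "1 / real b ^ Suc k \<le> \<rho>" "\<rho> < 1 / real b ^ k"
proof -
  have ex: "\<exists>j. 1 / real b ^ j \<le> \<rho>"
    using real_arch_pow_inv[of \<rho> "1 / real b"] assms by (auto simp: power_one_over intro: less_imp_le)
  define j where "j = (LEAST j. 1 / real b ^ j \<le> \<rho>)"
  have j: "1 / real b ^ j \<le> \<rho>" unfolding j_def using ex by (rule LeastI_ex)
  have "j > k0"
  proof (rule ccontr)
    assume "\<not> j > k0"
    hence "real b ^ j \<le> real b ^ k0" using assms(1) by (intro power_increasing) auto
    hence "1 / real b ^ k0 \<le> 1 / real b ^ j" using assms(1) by (intro divide_left_mono) auto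
    thus False using j assms(3) by simp
  qed
  then obtain k where k: "j = Suc k" "k \<ge> k0" by (cases j) auto
  have "\<not> 1 / real b ^ k \<le> \<rho>" using not_less_Least[of k "\<lambda>j. 1 / real b ^ j \<le> \<rho>"] k j_def by simp
  thus ?thesis using that[of k] k j by simp
qed

text \<open>With \<open>\<sigma> = b powr - s\<close>, an interval of length between
  \<open>b ^ - (k + 1)\<close> and \<open>b ^ - k\<close> has mass at most
  \<open>2 * \<epsilon> * \<sigma> ^ k\<close>, which is at most
  \<open>2 * \<epsilon> * b powr s\<close> times its length to the power \<open>s\<close>. The mass
  distribution principle bounds the measure below by the reciprocal of that constant, for every
  \<epsilon>. The hypothesis \<open>small\<close> says that \<open>s\<close> is below the dimension
  of the digit set.\<close>

lemma hausdorff_measure_limsup_digits: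
  fixes l m :: "nat \<Rightarrow> nat" and D :: "nat set" and s :: real
  assumes b: "b \<ge> 2" and D: "D \<subseteq> {..<b}" "e \<in> D" and s: "s \<ge> 0"
    and small: "real b powr s < real (card D)"
    and weights: "\<And>S \<kappa>. \<kappa> > 0 \<Longrightarrow> \<exists>F c. finite F \<and> (\<forall>n\<in>F. c n \<ge> 0 \<and> S \<le> l n \<and> l n \<le> m n) \<and>
      sum c F = 1 \<and>
      (\<forall>k. (\<Sum>n\<in>F. c n * (1 / real (card D)) ^ (l n + (k - m n))) \<le> \<kappa> * (1 / real b powr s) ^ k)"
    and A: "\<And>d x. (\<And>i. d i \<in> D) \<Longrightarrow> (\<And>S. \<exists>n. S \<le> l n \<and> (\<forall>i\<in>{l n..<m n}. d i = e)) \<Longrightarrow>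
      (\<lambda>i. real (d i) / real b ^ Suc i) sums x \<Longrightarrow> x \<in> A"
  shows "hausdorff_measure s A = \<infinity>"
proof -
  define \<sigma> where "\<sigma> = 1 / real b powr s"
  have bs: "real b powr s \<ge> 1" using b s by (simp add: ge_one_powr_ge_zero)
  have sig: "0 < \<sigma>" "\<sigma> \<le> 1" "1 / real (card D) < \<sigma>"
    using bs small less_le_trans[OF zero_less_one bs] unfolding \<sigma>_def
    by (simp_all add: divide_le_eq_1 frac_less2)
  have finD: "finite D" using D(1) finite_subset by blast
  have lower: "ennreal (1 / (2 * \<epsilon> * real b powr s)) \<le> hausdorff_measure s A"
    if eps: "0 < \<epsilon>" "\<epsilon> \<le> 1" for \<epsilon>
  proof -
    obtain M :: "(nat \<Rightarrow> nat \<Rightarrow> nat) measure" and dig k0 where M: "prob_space M"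
      and meas: "\<And>i. (\<lambda>\<omega>. dig \<omega> i) \<in> measurable M (count_space UNIV)"
      and AE: "AE \<omega> in M. (\<forall>i. dig \<omega> i \<in> D) \<and> (\<forall>S. \<exists>n. S \<le> l n \<and> (\<forall>i\<in>{l n..<m n}. dig \<omega> i = e))"
      and cyl: "\<And>w k. k \<ge> k0 \<Longrightarrow>
        emeasure M {\<omega> \<in> space M. \<forall>i<k. dig \<omega> i = w i} \<le> ennreal (\<epsilon> * \<sigma> ^ k)"
      using exists_digit_measure[OF finD D(2) eps sig(3) weights[folded \<sigma>_def]] by blast
    interpret prob_space M by fact
    define X where "X \<omega> = (\<Sum>i. real (dig \<omega> i) / real b ^ Suc i)" for \<omega>
    define \<delta> where "\<delta> = 1 / real b ^ Suc k0"
    have \<delta>: "0 < \<delta>" "\<delta> < 1 / real b ^ k0" using b by (auto simp: \<delta>_def field_simps)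
    have AEb: "AE \<omega> in M. \<forall>i. dig \<omega> i < b" using AE D(1) by (auto elim!: eventually_mono)
    have scale: "emeasure M (X -` {u..v} \<inter> space M) \<le> ennreal (2 * (\<epsilon> * \<sigma> ^ k))"
      if "k \<ge> k0" "v - u < 1 / real b ^ k" for u v k
      unfolding X_def using eps sig
      by (intro digit_interval_bound[OF M meas AEb b cyl[OF that(1)] that(2)]) auto
    have "ennreal (1 / (2 * \<epsilon> * real b powr s)) \<le> hausdorff_pre s \<delta> A"
    proof (rule mass_distribution_principle[OF M])
      have [measurable]: "(\<lambda>\<omega>. real (dig \<omega> i)) \<in> borel_measurable M" for i
        by (rule measurable_compose[OF meas]) simp
      show "X \<in> borel_measurable M" unfolding X_def by measurable
      show "AE \<omega> in M. X \<omega> \<in> A" using AE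
      proof eventually_elim
        case (elim \<omega>)
        have "(\<lambda>i. real (dig \<omega> i) / real b ^ Suc i) sums X \<omega>"
          unfolding X_def using elim D(1) b by (intro summable_sums summable_digits) auto
        thus ?case using elim by (intro A[of "dig \<omega>"]) auto
      qed
      show "0 < 2 * \<epsilon> * real b powr s" "0 \<le> s" using eps s b by auto
      fix u v :: real assume uv: "u \<le> v" "v - u \<le> \<delta>"
      show "emeasure M (X -` {u..v} \<inter> space M) \<le> ennreal (2 * \<epsilon> * real b powr s) * diam_pow s {u..v}"
      \<comment> \<open>For \<open>s = 0\<close> every nonempty interval has \<open>diam_pow\<close>
        equal to 1 and \<sigma> is 1, so the scale \<open>k0\<close> suffices.\<close>
      proof (cases "s = 0")
        case True
        thus ?thesis using scale[of k0 v u] uv \<delta> b by (simp add: \<sigma>_def diam_pow_def)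
      next
        case False
        show ?thesis
        \<comment> \<open>A single point has no scale of its own; its mass is 0 because the bound
          holds at all scales and \<sigma> is below 1.\<close>
        proof (cases "u = v")
          case True
          have "\<sigma> < 1" using s False b unfolding \<sigma>_def by (simp add: gr_one_powr)
          hence "(\<lambda>k. \<sigma> ^ k) \<longlonglongrightarrow> 0" using sig by (intro LIMSEQ_power_zero) auto
          hence "(\<lambda>k. ennreal (2 * (\<epsilon> * \<sigma> ^ k))) \<longlonglongrightarrow> ennreal (2 * (\<epsilon> * 0))"
            by (intro tendsto_ennrealI tendsto_mult tendsto_const)
          hence "emeasure M (X -` {u..v} \<inter> space M) \<le> ennreal (2 * (\<epsilon> * 0))"
          proof (rule LIMSEQ_le_const, intro exI[of _ k0] allI impI)
            fix k assume "k0 \<le> k"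
            thus "emeasure M (X -` {u..v} \<inter> space M) \<le> ennreal (2 * (\<epsilon> * \<sigma> ^ k))"
              using True b by (intro scale) auto
          qed
          thus ?thesis by simp
        next
          case neq: False
          have rho: "0 < v - u" "v - u < 1 / real b ^ k0" using uv neq \<delta> by auto
          obtain k where k: "k \<ge> k0" "1 / real b ^ Suc k \<le> v - u" "v - u < 1 / real b ^ k"
            using power_scale_exists[OF b rho] by blast
          have "\<sigma> ^ k = real b powr s * \<sigma> ^ Suc k" using b by (simp add: \<sigma>_def)
          also have "\<sigma> ^ Suc k = (1 / real b ^ Suc k) powr s"
          proof -
            have "(real b powr s) ^ Suc k = (real b ^ Suc k) powr s"
              using b by (simp add: powr_realpow[symmetric] powr_powr powr_power mult.commute del: power_Suc)
            thus ?thesis unfolding \<sigma>_def using b by (simp only: power_one_over powr_divide) simp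
          qed
          also have "\<dots> \<le> (v - u) powr s" using k(2) s b by (intro powr_mono2) auto
          finally have "\<sigma> ^ k \<le> real b powr s * (v - u) powr s" using b by (simp add: mult_left_mono)
          hence "2 * (\<epsilon> * \<sigma> ^ k) \<le> 2 * \<epsilon> * real b powr s * (v - u) powr s"
            using eps by (simp add: mult.assoc mult_left_mono)
          hence "ennreal (2 * (\<epsilon> * \<sigma> ^ k)) \<le> ennreal (2 * \<epsilon> * real b powr s * (v - u) powr s)"
            by (rule ennreal_leI)
          also have "\<dots> = ennreal (2 * \<epsilon> * real b powr s) * diam_pow s {u..v}"
            using False uv eps by (simp add: diam_pow_def ennreal_mult)
          finally show ?thesis using scale[OF k(1,3)] by (meson order_trans)
        qed
      qed
    qed
    also have "\<dots> \<le> hausdorff_measure s A"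
      unfolding hausdorff_measure_def using \<delta> by (intro SUP_upper) auto
    finally show ?thesis .
  qed
  show ?thesis
  proof (rule ccontr)
    assume "hausdorff_measure s A \<noteq> \<infinity>"
    then obtain r where r: "r \<ge> 0" "hausdorff_measure s A = ennreal r" by (cases "hausdorff_measure s A") auto
    \<comment> \<open>With this value the lower bound becomes \<open>r + 1\<close>, more than the
      supposed measure \<open>r\<close>.\<close>
    define \<epsilon> where "\<epsilon> = 1 / (2 * real b powr s * (r + 1))"
    have "2 * real b powr s * (r + 1) \<ge> 1 * 1"
      using bs r(1) by (intro mult_mono) auto
    hence "0 < \<epsilon>" "\<epsilon> \<le> 1" unfolding \<epsilon>_def by (auto simp: field_simps)
    from lower[OF this] have "ennreal (r + 1) \<le> ennreal r"
      using r b by (simp add: \<epsilon>_def)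
    thus False using r(1) by simp
  qed
qed

section \<open>Choice of the weights\<close>

lemma sum_power_inj_le:
  fixes x :: real
  assumes "0 \<le> x" "x < 1" "finite V" "inj_on f V"
  shows "(\<Sum>v\<in>V. x ^ f v) \<le> 1 / (1 - x)"
proof -
  have "(\<Sum>v\<in>V. x ^ f v) = (\<Sum>i\<in>f ` V. x ^ i)" using assms(4) by (simp add: sum.reindex)
  also have "\<dots> \<le> (\<Sum>i. x ^ i)" using assms by (intro sum_le_suminf summable_geometric) auto
  finally show ?thesis using assms by (simp add: suminf_geometric)
qed

text \<open>The terms are largest near \<open>v = k\<close> and decay geometrically on both sides:
  with ratio \<open>q / \<sigma>\<close> below \<open>k\<close>, and with ratio \<sigma> above,
  where \<open>k - v\<close> is truncated to 0.\<close>

lemma sum_two_sided_geometric_le: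
  fixes q \<sigma> :: real
  assumes "0 < q" "q < \<sigma>" "\<sigma> < 1" "finite V"
  shows "(\<Sum>v\<in>V. \<sigma> ^ v * q ^ (k - v)) \<le> (1 / (1 - q / \<sigma>) + 1 / (1 - \<sigma>)) * \<sigma> ^ k"
proof -
  have sig: "\<sigma> > 0" using assms by simp
  have lo: "\<sigma> ^ v * q ^ (k - v) = (q / \<sigma>) ^ (k - v) * \<sigma> ^ k" if "v \<le> k" for v
  proof -
    have "\<sigma> ^ k = \<sigma> ^ (k - v) * \<sigma> ^ v" using that by (simp add: power_add[symmetric])
    thus ?thesis using sig by (simp add: power_divide)
  qed
  have hi: "\<sigma> ^ v * q ^ (k - v) = \<sigma> ^ (v - k) * \<sigma> ^ k" if "\<not> v \<le> k" for v
    using that by (simp add: power_add[symmetric])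
  have "(\<Sum>v\<in>V. \<sigma> ^ v * q ^ (k - v))
      = (\<Sum>v\<in>(V \<inter> {v. v \<le> k}) \<union> (V \<inter> {v. \<not> v \<le> k}). \<sigma> ^ v * q ^ (k - v))"
    by (rule sum.cong) auto
  also have "\<dots> = (\<Sum>v\<in>V \<inter> {v. v \<le> k}. \<sigma> ^ v * q ^ (k - v))
      + (\<Sum>v\<in>V \<inter> {v. \<not> v \<le> k}. \<sigma> ^ v * q ^ (k - v))"
    using assms(4) by (intro sum.union_disjoint) auto
  also have "(\<Sum>v\<in>V \<inter> {v. v \<le> k}. \<sigma> ^ v * q ^ (k - v)) = (\<Sum>v\<in>V \<inter> {v. v \<le> k}. (q / \<sigma>) ^ (k - v)) * \<sigma> ^ k"
    unfolding sum_distrib_right by (rule sum.cong) (use lo in auto)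
  also have "(\<Sum>v\<in>V \<inter> {v. \<not> v \<le> k}. \<sigma> ^ v * q ^ (k - v)) = (\<Sum>v\<in>V \<inter> {v. \<not> v \<le> k}. \<sigma> ^ (v - k)) * \<sigma> ^ k"
    unfolding sum_distrib_right by (rule sum.cong) (use hi in auto)
  also have "(\<Sum>v\<in>V \<inter> {v. v \<le> k}. (q / \<sigma>) ^ (k - v)) * \<sigma> ^ k + (\<Sum>v\<in>V \<inter> {v. \<not> v \<le> k}. \<sigma> ^ (v - k)) * \<sigma> ^ k
      \<le> 1 / (1 - q / \<sigma>) * \<sigma> ^ k + 1 / (1 - \<sigma>) * \<sigma> ^ k"
    using assms sig by (intro add_mono mult_right_mono sum_power_inj_le) (auto simp: inj_on_def)
  finally show ?thesis by (simp add: distrib_right)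
qed

text \<open>
  Only the largest index with a given value of \<open>m\<close> is kept: this costs a constant factor because
  \<open>r ^ n\<close> grows geometrically, and it makes the sum over the surviving indices geometric in \<open>m n\<close>.
\<close>

lemma exists_injective_subfamily:
  fixes m :: "nat \<Rightarrow> nat" and r \<sigma> :: real
  assumes "r > 1" "\<sigma> > 0" and W: "finite W"
  obtains F where "F \<subseteq> W" "inj_on m F"
    "(\<Sum>n\<in>W. r ^ n * \<sigma> ^ m n) \<le> r / (r - 1) * (\<Sum>n\<in>F. r ^ n * \<sigma> ^ m n)"
proof -
  define g where "g n = Max {n' \<in> W. m n' = m n}" for n
  have g: "g n \<in> W" "m (g n) = m n" "n \<le> g n" if "n \<in> W" for n
  proof -
    have fin: "finite {n' \<in> W. m n' = m n}" using W by simp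
    have "g n \<in> {n' \<in> W. m n' = m n}"
      unfolding g_def by (rule Max_in[OF fin]) (use that in auto)
    thus "g n \<in> W" "m (g n) = m n" by auto
    show "n \<le> g n" unfolding g_def by (rule Max_ge[OF fin]) (use that in auto)
  qed
  show ?thesis
  proof (rule that[of "g ` W"])
    show "g ` W \<subseteq> W" using g(1) by blast
    show "inj_on m (g ` W)"
    proof (rule inj_onI)
      fix y y' assume "y \<in> g ` W" "y' \<in> g ` W" and eq: "m y = m y'"
      then obtain x x' where x: "x \<in> W" "y = g x" "x' \<in> W" "y' = g x'" by blast
      hence "m x = m x'" using eq g(2) by simp
      thus "y = y'" using x by (simp add: g_def)
    qed
    have "(\<Sum>n\<in>W. r ^ n * \<sigma> ^ m n) = (\<Sum>y\<in>g ` W. \<Sum>n | n \<in> W \<and> g n = y. r ^ n * \<sigma> ^ m n)"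
      using W by (intro sum.group[symmetric]) auto
    also have "\<dots> \<le> (\<Sum>y\<in>g ` W. r / (r - 1) * (r ^ y * \<sigma> ^ m y))"
    proof (rule sum_mono)
      fix y assume "y \<in> g ` W"
      have "(\<Sum>n | n \<in> W \<and> g n = y. r ^ n * \<sigma> ^ m n) = (\<Sum>n | n \<in> W \<and> g n = y. r ^ n * \<sigma> ^ m y)"
        using g(2) by (intro sum.cong) auto
      \<comment> \<open>\<open>g\<close> never decreases an index, so the fibre over
        \<open>y\<close> consists of indices up to \<open>y\<close>, and \<open>m\<close> is
        constant on it.\<close>
      also have "\<dots> \<le> (\<Sum>n<Suc y. r ^ n * \<sigma> ^ m y)"
        using assms(1,2) g(3) by (intro sum_mono2) (auto simp: less_Suc_eq_le)
      also have "\<dots> = (r ^ Suc y - 1) / (r - 1) * \<sigma> ^ m y"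
        using assms(1) by (simp only: sum_distrib_right[symmetric] geometric_sum)
      also have "\<dots> \<le> r ^ Suc y / (r - 1) * \<sigma> ^ m y"
        using assms(1,2) by (intro mult_right_mono divide_right_mono) auto
      finally show "(\<Sum>n | n \<in> W \<and> g n = y. r ^ n * \<sigma> ^ m n) \<le> r / (r - 1) * (r ^ y * \<sigma> ^ m y)"
        by simp
    qed
    finally show "(\<Sum>n\<in>W. r ^ n * \<sigma> ^ m n) \<le> r / (r - 1) * (\<Sum>n\<in>g ` W. r ^ n * \<sigma> ^ m n)"
      by (simp add: sum_distrib_left)
  qed
qed

lemma not_summable_tail_sum:
  fixes a :: "nat \<Rightarrow> real"
  assumes "\<And>n. a n \<ge> 0" "\<not> summable a"
  shows "\<exists>n2. (\<Sum>n = n1..<n2. a n) > K"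
proof (rule ccontr)
  assume *: "\<not> ?thesis"
  have "summable a"
  proof (rule bounded_imp_summable[OF assms(1)])
    fix n
    have "(\<Sum>i\<le>n. a i) \<le> (\<Sum>i\<in>{..<n1} \<union> {n1..<Suc n}. a i)"
      using assms(1) by (intro sum_mono2) auto
    also have "\<dots> \<le> (\<Sum>i<n1. a i) + K"
    proof (subst sum.union_disjoint)
      have "sum a {n1..<Suc n} \<le> K" using * not_less by blast
      thus "(\<Sum>i<n1. a i) + sum a {n1..<Suc n} \<le> (\<Sum>i<n1. a i) + K" by simp
    qed auto
    finally show "(\<Sum>i\<le>n. a i) \<le> (\<Sum>i<n1. a i) + K" .
  qed
  thus False using assms(2) by simp
qed

text \<open>The weights are proportional to \<open>r ^ n * \<sigma> ^ m n\<close>. Each numerator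
  factors as \<open>r ^ n * q ^ l n\<close>, bounded by \<open>C\<close>, times
  \<open>\<sigma> ^ m n * q ^ (k - m n)\<close>, whose sum over distinct values of
  \<open>m n\<close> is of order \<open>\<sigma> ^ k\<close>. Divergence makes the normalising
  constant as large as \<kappa> requires.\<close>

lemma exists_weights:
  fixes l m :: "nat \<Rightarrow> nat" and r q \<sigma> C \<kappa> :: real
  assumes r: "r > 1" and qs: "0 < q" "q < \<sigma>" "\<sigma> \<le> 1" and C: "\<And>n. r ^ n * q ^ l n \<le> C"
    and l: "filterlim l at_top sequentially" and lm: "\<forall>\<^sub>F n in sequentially. l n \<le> m n"
    and div: "\<not> summable (\<lambda>n. r ^ n * \<sigma> ^ m n)" and "\<kappa> > 0"
  shows "\<exists>F c. finite F \<and> (\<forall>n\<in>F. c n \<ge> 0 \<and> S \<le> l n \<and> l n \<le> m n) \<and> sum c F = 1 \<and>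
    (\<forall>k. (\<Sum>n\<in>F. c n * q ^ (l n + (k - m n))) \<le> \<kappa> * \<sigma> ^ k)"
proof -
  obtain T where T: "q ^ T < \<kappa>" using real_arch_pow_inv[of \<kappa> q] \<open>\<kappa> > 0\<close> qs by auto
  have "\<forall>\<^sub>F n in sequentially. max S T \<le> l n \<and> l n \<le> m n"
    using l[unfolded filterlim_at_top, rule_format, of "max S T"] lm by (rule eventually_conj)
  then obtain n1 where n1: "\<And>n. n \<ge> n1 \<Longrightarrow> max S T \<le> l n \<and> l n \<le> m n"
    unfolding eventually_sequentially by blast
  show ?thesis
  proof (cases "\<sigma> = 1")
    case True
    have "q ^ (l n1 + (k - m n1)) \<le> \<kappa>" for k
    proof -
      have "q ^ (l n1 + (k - m n1)) \<le> q ^ T"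
        using n1[of n1] qs True by (intro power_decreasing) auto
      thus ?thesis using T by simp
    qed
    thus ?thesis using n1[of n1] True by (intro exI[of _ "{n1}"] exI[of _ "\<lambda>_. 1"]) auto
  next
    case False
    hence sig: "0 < \<sigma>" "\<sigma> < 1" using qs by auto
    define H where "H = 1 / (1 - q / \<sigma>) + 1 / (1 - \<sigma>)"
    have H: "H > 0" unfolding H_def using sig qs by (intro add_pos_pos) auto
    have C0: "C > 0" using C[of 0] qs by (auto intro: less_le_trans[rotated])
    define a where "a n = r ^ n * \<sigma> ^ m n" for n
    have a: "a n > 0" for n using r sig by (simp add: a_def)
    \<comment> \<open>The factor \<open>r / (r - 1)\<close> anticipates the loss in passing to
      indices with distinct values of \<open>m\<close>.\<close>
    obtain n2 where n2: "(\<Sum>n = n1..<n2. a n) > r / (r - 1) * (C * H / \<kappa>)"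
      using not_summable_tail_sum[of a] a div unfolding a_def by (meson less_imp_le)
    obtain F where F: "F \<subseteq> {n1..<n2}" "inj_on m F"
      "(\<Sum>n = n1..<n2. a n) \<le> r / (r - 1) * (\<Sum>n\<in>F. a n)"
      using exists_injective_subfamily[OF r sig(1), of "{n1..<n2}" m] unfolding a_def by blast
    have finF: "finite F" using F(1) finite_subset by blast
    define A where "A = (\<Sum>n\<in>F. a n)"
    have "r / (r - 1) * (C * H / \<kappa>) < r / (r - 1) * A" using n2 F(3) by (simp add: A_def)
    hence A: "C * H / \<kappa> < A" using r by (subst (asm) mult_less_cancel_left_pos) auto
    hence A0: "A > 0" using C0 H \<open>\<kappa> > 0\<close> by (auto intro: less_trans[rotated])
    have "(\<Sum>n\<in>F. a n / A * q ^ (l n + (k - m n))) \<le> \<kappa> * \<sigma> ^ k" for k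
    proof -
      have "(\<Sum>n\<in>F. a n / A * q ^ (l n + (k - m n)))
          = (\<Sum>n\<in>F. (r ^ n * q ^ l n) * (\<sigma> ^ m n * q ^ (k - m n))) / A"
        unfolding sum_divide_distrib by (rule sum.cong) (auto simp: a_def power_add)
      also have "\<dots> \<le> (\<Sum>n\<in>F. C * (\<sigma> ^ m n * q ^ (k - m n))) / A"
        using A0 C sig qs by (intro divide_right_mono sum_mono mult_right_mono) auto
      also have "\<dots> = C * (\<Sum>v\<in>m ` F. \<sigma> ^ v * q ^ (k - v)) / A"
        using F(2) by (simp add: sum.reindex sum_distrib_left)
      also have "\<dots> \<le> C * (H * \<sigma> ^ k) / A"
        using sum_two_sided_geometric_le[OF qs(1,2) sig(2), of "m ` F" k] finF A0 C0
        unfolding H_def by (intro divide_right_mono mult_left_mono) auto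
      also have "\<dots> = (C * H / A) * \<sigma> ^ k" by simp
      also have "\<dots> \<le> \<kappa> * \<sigma> ^ k"
        using A A0 \<open>\<kappa> > 0\<close> sig by (intro mult_right_mono) (auto simp: field_simps)
      finally show ?thesis .
    qed
    moreover have "(\<Sum>n\<in>F. a n / A) = 1" using A0 by (simp add: sum_divide_distrib[symmetric] A_def)
    moreover have "a n / A \<ge> 0 \<and> S \<le> l n \<and> l n \<le> m n" if "n \<in> F" for n
      using n1[of n] that F(1) a[of n] A0 by auto
    ultimately show ?thesis using finF by (intro exI[of _ F] exI[of _ "\<lambda>n. a n / A"]) blast
  qed
qed

section \<open>Approximation by the rationals with denominator a power of t\<close>

text \<open>For a fixed \<open>n\<close> only finitely many numerators \<open>p\<close> come within
  \<open>\<psi> n\<close> of \<open>x\<close>, so infinitely many pairs force infinitely many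
  exponents.\<close>

lemma well_approx_frequently:
  assumes "u \<ge> 2" "x \<in> well_approx u \<psi>"
  shows "\<exists>\<^sub>\<infinity>n. n \<ge> 1 \<and> (\<exists>p::int. \<bar>x - real_of_int p / real u ^ n\<bar> < \<psi> n)"
proof -
  let ?P = "{(p :: int, n :: nat). 1 \<le> n \<and> \<bar>x - real_of_int p / real u ^ n\<bar> < \<psi> n}"
  let ?N = "{n. n \<ge> 1 \<and> (\<exists>p::int. \<bar>x - real_of_int p / real u ^ n\<bar> < \<psi> n)}"
  have inf: "infinite ?P" using assms(2) unfolding well_approx_def by simp
  have "finite ?P" if fin: "finite ?N"
  proof (rule finite_subset)
    show "?P \<subseteq> (\<Union>n\<in>?N. {\<lfloor>real u ^ n * (x - \<psi> n)\<rfloor>..\<lceil>real u ^ n * (x + \<psi> n)\<rceil>} \<times> {n})"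
    proof safe
      fix p :: int and n :: nat assume n: "1 \<le> n" and lt: "\<bar>x - real_of_int p / real u ^ n\<bar> < \<psi> n"
      have un: "real u ^ n > 0" using assms(1) by simp
      have "real u ^ n * (x - \<psi> n) < p" "p < real u ^ n * (x + \<psi> n)"
        using lt un by (auto simp: abs_less_iff field_simps)
      hence "p \<in> {\<lfloor>real u ^ n * (x - \<psi> n)\<rfloor>..\<lceil>real u ^ n * (x + \<psi> n)\<rceil>}"
        unfolding atLeastAtMost_iff by linarith
      thus "(p, n) \<in> (\<Union>n\<in>?N. {\<lfloor>real u ^ n * (x - \<psi> n)\<rfloor>..\<lceil>real u ^ n * (x + \<psi> n)\<rceil>} \<times> {n})"
        using n lt by blast
    qed
    show "finite (\<Union>n\<in>?N. {\<lfloor>real u ^ n * (x - \<psi> n)\<rfloor>..\<lceil>real u ^ n * (x + \<psi> n)\<rceil>} \<times> {n})"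
      using fin by (intro finite_UN_I) auto
  qed
  thus ?thesis using inf unfolding Inf_many_def by blast
qed

lemma well_approxI:
  assumes "x \<in> {0..1}"
    and "\<And>n0. \<exists>n\<ge>n0. n \<ge> 1 \<and> (\<exists>p::int. \<bar>x - real_of_int p / real u ^ n\<bar> < \<psi> n)"
  shows "x \<in> well_approx u \<psi>"
proof -
  let ?P = "{(p :: int, n :: nat). 1 \<le> n \<and> \<bar>x - real_of_int p / real u ^ n\<bar> < \<psi> n}"
  have "infinite (snd ` ?P)"
    unfolding infinite_nat_iff_unbounded_le
  proof
    fix n0
    obtain n p where n: "n \<ge> n0" "n \<ge> 1" "\<bar>x - real_of_int p / real u ^ n\<bar> < \<psi> n"
      using assms(2) by blast
    hence "(p, n) \<in> ?P" by simp
    hence "n \<in> snd ` ?P" by force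
    thus "\<exists>n\<ge>n0. n \<in> snd ` ?P" using n(1) by blast
  qed
  hence "infinite ?P" using finite_imageI by blast
  thus ?thesis using assms(1) unfolding well_approx_def by simp
qed

context same_primes
begin

text \<open>Over the denominator \<open>b ^ m\<close> the rational has a numerator divisible by
  \<open>b_star b t ^ (m - L)\<close>. Being close to \<open>x\<close>, it is an endpoint of the
  b-adic interval of order \<open>m\<close> around \<open>x\<close>; the divisibility then forces
  the last \<open>m - L\<close> digits and the fraction reduces to denominator
  \<open>b ^ L\<close>.\<close>

lemma approximant_near_missing_digit_set:
  assumes D: "D \<subseteq> {0..b - 1} - (D1 b t \<union> D2 b t)" and x: "x \<in> missing_digit_set b D"
    and m: "alpha_max b t * real n \<le> real m" and L: "alpha_min b t * real n \<le> real L" "L \<le> m"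
    and near: "\<bar>x - real_of_int p / real t ^ n\<bar> < 1 / real b ^ Suc m"
  shows "\<exists>a \<in> prefix_vals b D L \<union> Suc ` prefix_vals b D L. real_of_int p / real t ^ n = real a / real b ^ L"
proof -
  obtain d where d: "\<And>i. d i \<in> D" "(\<lambda>i. real (d i) / real b ^ Suc i) sums x"
    using x unfolding missing_digit_set_def by blast
  have db: "d i < b" for i using d(1)[of i] D b_ge by fastforce
  have bm: "real b ^ m > 0" using b_ge by simp
  define k where "k = m - L"
  obtain h where h: "b ^ m = (t ^ n * b_star b t ^ k) * h"
    using power_times_b_star_dvd[OF m, of k] L unfolding k_def by (auto simp: dvd_def)
  define z where "z = p * int (b_star b t ^ k * h)"
  have hm: "real b ^ m = real t ^ n * real (b_star b t ^ k * h)"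
    using arg_cong[OF h, of real] by (simp add: mult_ac)
  have "h > 0" using h b_ge by (intro Nat.gr0I) simp
  hence t0: "real t ^ n > 0" "real (b_star b t ^ k * h) > 0" using t_ge b_star_pos by simp_all
  have pz: "real_of_int p / real t ^ n = real_of_int z / real b ^ m"
    using t0 by (simp add: z_def hm del: of_nat_mult of_nat_power)
  have "\<bar>real b ^ m * x - z\<bar> = real b ^ m * \<bar>x - real_of_int z / real b ^ m\<bar>"
    using bm by (simp add: abs_mult_pos[symmetric] field_simps abs_mult flip: abs_of_pos)
  also have "\<dots> < real b ^ m * (1 / real b ^ Suc m)"
    using near bm unfolding pz by (rule mult_strict_left_mono)
  also have "\<dots> \<le> 1" using b_ge by simp
  finally have lt: "\<bar>real b ^ m * x - z\<bar> < 1" .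
  have bounds: "real (prefix_val b d m) \<le> real b ^ m * x" "real b ^ m * x \<le> real (prefix_val b d m) + 1"
    using digits_sums_bounds[OF db d(2)] by blast+
  \<comment> \<open>An integer at distance less than 1 from a point of a closed interval between
    consecutive integers is one of its endpoints.\<close>
  have zz: "z = int (prefix_val b d m) \<or> z = int (prefix_val b d m + 1)" using bounds lt by linarith
  have dvd: "int (b_star b t ^ k) dvd z" by (simp add: z_def)
  have km: "k \<le> m" "m - k = L" using L by (auto simp: k_def)
  have bL: "real b ^ m = real b ^ k * real b ^ L" using L by (simp add: k_def power_add[symmetric])
  note fac = b_star_times_fast_part coprime_b_star_fast_part db
  from zz show ?thesis
  proof
    assume z: "z = int (prefix_val b d m)"
    have dv: "b_star b t ^ k dvd prefix_val b d m" using dvd z by (simp only: int_dvd_int_iff)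
    have ex: "d i \<noteq> j * b_star b t" if "1 \<le> j" "j \<le> fast_part - 1" for i j
      using d(1)[of i] D that b_div_b_star unfolding D1_def by auto
    have "prefix_val b d m = b ^ k * prefix_val b d L"
      by (rule coprime_divisor_prefix_val[OF fac ex dv km(1), unfolded km(2)])
    hence "real_of_int p / real t ^ n = real (prefix_val b d L) / real b ^ L"
      using b_ge by (simp add: pz z bL)
    thus ?thesis using d(1) unfolding prefix_vals_def by blast
  next
    assume z: "z = int (prefix_val b d m + 1)"
    have dv: "b_star b t ^ k dvd prefix_val b d m + 1" using dvd z by (simp only: int_dvd_int_iff)
    have ex: "d i \<noteq> j * b_star b t - 1" if "1 \<le> j" "j \<le> fast_part - 1" for i j
      using d(1)[of i] D that b_div_b_star unfolding D2_def by auto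
    have *: "prefix_val b d m + 1 = b ^ k * (prefix_val b d L + 1)"
      by (rule coprime_divisor_prefix_val_Suc[OF fac ex dv km(1), unfolded km(2)])
    have "real_of_int p / real t ^ n = real (Suc (prefix_val b d L)) / real b ^ L"
      using b_ge unfolding pz z * by (simp add: bL field_simps)
    thus ?thesis using d(1) unfolding prefix_vals_def by blast
  qed
qed

text \<open>The run makes one endpoint of the b-adic interval of order \<open>m\<close> around
  \<open>x\<close> a multiple of \<open>b ^ - l\<close>: the left one for \<open>e = 0\<close>, the
  right one for \<open>e = b - 1\<close>. Since \<open>b ^ l\<close> divides \<open>t ^ n\<close>,
  that endpoint has denominator \<open>t ^ n\<close>.\<close>

lemma constant_run_approximant:
  assumes d: "\<And>i. d i < b" and x: "(\<lambda>i. real (d i) / real b ^ Suc i) sums x"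
    and e: "e = 0 \<or> e = b - 1" and run: "\<And>i. i \<in> {l..<m} \<Longrightarrow> d i = e" and lm: "l \<le> m"
    and l: "real l \<le> alpha_min b t * real n"
  shows "\<exists>p::int. \<bar>x - real_of_int p / real t ^ n\<bar> \<le> 1 / real b ^ m"
proof -
  have bl: "real b ^ l > 0" "real b ^ m > 0" using b_ge by simp_all
  have bm: "real b ^ m = real b ^ (m - l) * real b ^ l" using lm by (simp add: power_add[symmetric])
  obtain h where h: "t ^ n = b ^ l * h" using power_dvd_power[OF l] by (auto simp: dvd_def)
  hence "h > 0" using t_ge by (intro Nat.gr0I) simp
  have th: "real t ^ n = real b ^ l * real h" using arg_cong[OF h, of real] by simp
  have conv: "real_of_int (int (a * h)) / real t ^ n = real (b ^ (m - l) * a) / real b ^ m" for a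
    using bl \<open>h > 0\<close> b_ge unfolding th bm by (simp add: field_simps)
  have bounds: "real (prefix_val b d m) / real b ^ m \<le> x" "x \<le> real (prefix_val b d m + 1) / real b ^ m"
    using digits_sums_bounds[OF d x, of m] bl by (simp_all add: field_simps)
  have gap: "real (prefix_val b d m + 1) / real b ^ m = real (prefix_val b d m) / real b ^ m + 1 / real b ^ m"
    by (simp add: add_divide_distrib)
  from e show ?thesis
  proof
    assume "e = 0"
    hence eq: "prefix_val b d m = b ^ (m - l) * prefix_val b d l"
      using prefix_val_const_zero[OF lm] run by simp
    show ?thesis using bounds gap conv[of "prefix_val b d l", unfolded eq[symmetric]]
      by (intro exI[of _ "int (prefix_val b d l * h)"]) linarith
  next
    assume "e = b - 1"
    hence eq: "prefix_val b d m + 1 = b ^ (m - l) * (prefix_val b d l + 1)"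
      using prefix_val_const_max[OF lm] run b_ge by simp
    show ?thesis using bounds gap conv[of "prefix_val b d l + 1", unfolded eq[symmetric]]
      by (intro exI[of _ "int ((prefix_val b d l + 1) * h)"]) linarith
  qed
qed

end

section \<open>The zero-infinity law\<close>

text \<open>Rounds a radius down to a power of \<open>b\<close> at the cost of a factor
  \<open>b\<close>, by taking the least suitable exponent.\<close>

lemma first_power_below:
  fixes b :: nat and r :: real
  assumes "b \<ge> 2" "0 < r" "r \<le> 1 / real b ^ Suc M"
  obtains m where "m > Suc M" "1 / real b ^ m < r" "r \<le> real b / real b ^ m"
proof -
  have "\<exists>j. 1 / real b ^ j < r"
    using real_arch_pow_inv[of r "1 / real b"] assms by (auto simp: power_one_over)
  define m where "m = (LEAST j. 1 / real b ^ j < r)"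
  have m: "1 / real b ^ m < r" unfolding m_def by (rule LeastI_ex) fact
  have "m > Suc M"
  proof (rule ccontr)
    assume "\<not> m > Suc M"
    hence "real b ^ m \<le> real b ^ Suc M" using assms(1) by (intro power_increasing) auto
    hence "1 / real b ^ Suc M \<le> 1 / real b ^ m" using assms(1) by (intro divide_left_mono) auto
    thus False using m assms(3) by simp
  qed
  then obtain k where k: "m = Suc k" by (cases m) auto
  have "\<not> 1 / real b ^ k < r" using not_less_Least[of k "\<lambda>j. 1 / real b ^ j < r"] k m_def by simp
  hence "r \<le> real b / real b ^ m" using k assms(1) by simp
  thus ?thesis using that[of m] m \<open>m > Suc M\<close> by simp
qed

lemma powr_power_eq:
  fixes x :: real
  assumes "x > 0"
  shows "(x ^ n) powr a = (x powr a) ^ n"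
  using assms by (simp add: powr_realpow[symmetric] powr_powr powr_power mult.commute)

locale digit_approximation = same_primes +
  fixes D :: "nat set" and \<psi> :: "nat \<Rightarrow> real" and s :: real
  assumes D_sub: "D \<subseteq> {0..b - 1} - (D1 b t \<union> D2 b t)" and card_D: "card D \<ge> 2"
    and indep: "ln (real b) / ln (real t) \<notin> \<rat>"
    and psi_pos: "\<And>n. n \<ge> 1 \<Longrightarrow> \<psi> n > 0"
    and psi_le: "\<forall>\<^sub>F n in sequentially. \<psi> n \<le> real b powi (- \<lceil>alpha_max b t * real n\<rceil> - 1)"
    and s_ge: "s \<ge> 0"
begin

text \<open>The ceiling in the hypothesis on \<psi>, as a natural number.\<close>

definition level :: "nat \<Rightarrow> nat" where
  "level n = nat \<lceil>alpha_max b t * real n\<rceil>"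

text \<open>Since \<open>b powr digit_dim b D = card D\<close>, the power \<open>growth ^ n\<close>
  is the factor \<open>b powr (alpha_min b t * digit_dim b D * n)\<close> of the series.\<close>

definition growth :: real where
  "growth = real (card D) powr alpha_min b t"

lemma D_lt: "D \<subseteq> {..<b}"
  using D_sub b_ge by fastforce

lemma finite_D: "finite D"
  using D_lt finite_subset by blast

lemma alpha_less: "alpha_min b t < alpha_max b t"
  using alpha_min_less_max[OF indep] .

lemma level_ge: "alpha_max b t * real n \<le> real (level n)"
  unfolding level_def by linarith

lemma growth_gt_1: "growth > 1"
  unfolding growth_def using card_D alpha_min_pos by (simp add: gr_one_powr)

lemma growth_power: "growth ^ n = real (card D) powr (alpha_min b t * real n)"
  unfolding growth_def using card_D by (simp add: powr_power mult.commute)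

lemma powr_dim: "real b powr (alpha_min b t * digit_dim b D * real n) = growth ^ n"
proof -
  have dim: "real b powr digit_dim b D = real (card D)"
    using b_ge card_D by (simp add: digit_dim_def powr_def)
  have "real b powr (alpha_min b t * digit_dim b D * real n)
      = real b powr (digit_dim b D * (alpha_min b t * real n))" by (simp add: mult_ac)
  also have "\<dots> = (real b powr digit_dim b D) powr (alpha_min b t * real n)"
    by (simp only: powr_powr)
  finally show ?thesis by (simp only: dim growth_power)
qed

lemma psi_le_level: "\<forall>\<^sub>F n in sequentially. n \<ge> 1 \<and> \<psi> n \<le> 1 / real b ^ Suc (level n)"
  using psi_le eventually_ge_at_top[of 1]
proof eventually_elim
  case (elim n)
  have "alpha_max b t * real n \<ge> 0" using alpha_min_pos alpha_less by simp
  hence "- \<lceil>alpha_max b t * real n\<rceil> - 1 = - int (Suc (level n))" unfolding level_def by simp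
  thus ?case using elim by (simp only: power_int_minus power_int_of_nat inverse_eq_divide)
qed

lemma psi_le_power: "\<forall>\<^sub>F n in sequentially. n \<ge> 1 \<and> \<psi> n \<le> (real b powr - alpha_max b t) ^ n"
  using psi_le_level
proof eventually_elim
  case (elim n)
  have "1 / real b ^ Suc (level n) = real b powr - real (Suc (level n))"
    using b_ge by (simp only: powr_minus_divide powr_realpow of_nat_0_less_iff)
  also have "\<dots> \<le> real b powr - (alpha_max b t * real n)"
    using level_ge[of n] b_ge by (intro powr_mono) auto
  also have "\<dots> = (real b powr - alpha_max b t) ^ n" using b_ge by (simp add: powr_power mult.commute)
  finally show ?case using elim by simp
qed

lemma psi_tendsto_0: "\<psi> \<longlonglongrightarrow> 0"
proof (rule tendsto_sandwich[of "\<lambda>_. 0" _ _ "\<lambda>n. (real b powr - alpha_max b t) ^ n"])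
  have "real b powr - alpha_max b t < real b powr 0"
    using b_ge alpha_min_pos alpha_less by (intro powr_less_mono) auto
  thus "(\<lambda>n. (real b powr - alpha_max b t) ^ n) \<longlonglongrightarrow> 0"
    using b_ge by (intro LIMSEQ_power_zero) auto
  show "\<forall>\<^sub>F n in sequentially. 0 \<le> \<psi> n"
    using eventually_ge_at_top[of 1] by eventually_elim (use psi_pos in \<open>auto intro: less_imp_le\<close>)
  show "\<forall>\<^sub>F n in sequentially. \<psi> n \<le> (real b powr - alpha_max b t) ^ n"
    using psi_le_power by (auto elim: eventually_mono)
qed simp

text \<open>The approximants of exponent \<open>n\<close> that come close to the missing digit set
  number at most a constant times \<open>growth ^ n\<close>; balls of radius \<open>\<psi> n\<close>
  around them form the cover.\<close>

lemma measure_zero: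
  assumes summ: "summable (\<lambda>n. \<psi> n powr s * growth ^ n)"
  shows "hausdorff_measure s (well_approx t \<psi> \<inter> missing_digit_set b D) = 0"
proof -
  \<comment> \<open>For \<open>s = 0\<close> all terms with \<open>n \<ge> 1\<close> are at least 1,
    contrary to summability.\<close>
  have "s \<noteq> 0"
  proof
    assume s0: "s = 0"
    have "(\<lambda>n. \<psi> n powr s * growth ^ n) \<longlonglongrightarrow> 0" using summ by (rule summable_LIMSEQ_zero)
    hence "\<forall>\<^sub>F n in sequentially. \<psi> n powr s * growth ^ n < 1" by (rule order_tendstoD) simp
    moreover have "\<forall>\<^sub>F n in sequentially. 1 \<le> \<psi> n powr s * growth ^ n"
      using eventually_ge_at_top[of 1]
    proof eventually_elim
      case (elim n)
      have "growth ^ n \<ge> 1" using growth_gt_1 by (simp add: one_le_power)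
      thus ?case using psi_pos[OF elim] s0 by simp
    qed
    ultimately have "\<forall>\<^sub>F n in sequentially. False" by eventually_elim simp
    thus False by simp
  qed
  hence s_pos: "s > 0" using s_ge by simp
  define L where "L n = nat \<lceil>alpha_min b t * real n\<rceil>" for n
  define PV where "PV n = prefix_vals b D (L n)" for n
  define C where "C n = (\<lambda>a. real a / real b ^ L n) ` (PV n \<union> Suc ` PV n)" for n
  \<comment> \<open>The value \<open>\<psi> 0\<close> may be negative, whereas radii must be
    nonnegative for all indices.\<close>
  define r where "r n = (if n = 0 then 0 else \<psi> n)" for n
  have PV: "finite (PV n)" "card (PV n) \<le> card D ^ L n" for n
    using prefix_vals_finite_card[OF finite_D] unfolding PV_def by blast+
  have finC: "finite (C n)" for n unfolding C_def using PV by simp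
  have cardC: "real (card (C n)) \<le> 2 * real (card D) * growth ^ n" for n
  proof -
    have "card (C n) \<le> card (PV n \<union> Suc ` PV n)" unfolding C_def using PV by (intro card_image_le) simp
    also have "\<dots> \<le> card (PV n) + card (Suc ` PV n)" by (rule card_Un_le)
    also have "\<dots> \<le> 2 * card D ^ L n" using PV(2)[of n] card_image_le[OF PV(1), of Suc n] by simp
    finally have "real (card (C n)) \<le> 2 * real (card D) ^ L n"
      by (metis of_nat_le_iff of_nat_mult of_nat_numeral of_nat_power)
    also have "real (card D) ^ L n = real (card D) powr real (L n)"
      using card_D by (simp add: powr_realpow)
    \<comment> \<open>Rounding the number of free digits up costs at most a factor
      \<open>card D\<close>.\<close>
    also have "\<dots> \<le> real (card D) powr (1 + alpha_min b t * real n)"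
      using card_D alpha_min_pos ceiling_correct[of "alpha_min b t * real n"]
      by (intro powr_mono) (auto simp: L_def)
    also have "\<dots> = real (card D) * growth ^ n" using card_D by (simp add: powr_add growth_power)
    finally show ?thesis by simp
  qed
  show ?thesis
  proof (rule hausdorff_measure_limsup_balls[OF s_pos finC])
    show "r n \<ge> 0" for n using psi_pos[of n] by (cases "n = 0") (auto simp: r_def)
    have "\<forall>\<^sub>F n in sequentially. \<psi> n = r n"
      using eventually_ge_at_top[of 1] by eventually_elim (simp add: r_def)
    thus "r \<longlonglongrightarrow> 0" using psi_tendsto_0 by (rule Lim_transform_eventually[rotated])
    show "summable (\<lambda>n. real (card (C n)) * r n powr s)"
    proof (rule summable_comparison_test')
      show "summable (\<lambda>n. 2 * real (card D) * (\<psi> n powr s * growth ^ n))"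
        using summ by (rule summable_mult)
      fix n :: nat assume "n \<ge> 1"
      hence "r n = \<psi> n" by (simp add: r_def)
      hence "real (card (C n)) * r n powr s \<le> (2 * real (card D) * growth ^ n) * \<psi> n powr s"
        using cardC[of n] by (simp add: mult_right_mono)
      thus "norm (real (card (C n)) * r n powr s) \<le> 2 * real (card D) * (\<psi> n powr s * growth ^ n)"
        by (simp add: mult_ac)
    qed
    fix x assume x: "x \<in> well_approx t \<psi> \<inter> missing_digit_set b D"
    hence "\<exists>\<^sub>\<infinity>n. n \<ge> 1 \<and> (\<exists>p::int. \<bar>x - real_of_int p / real t ^ n\<bar> < \<psi> n)"
      using well_approx_frequently[OF t_ge] by blast
    hence "\<exists>\<^sub>F n in sequentially. n \<ge> 1 \<and> (\<exists>p::int. \<bar>x - real_of_int p / real t ^ n\<bar> < \<psi> n)"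
      by (simp add: cofinite_eq_sequentially)
    hence "\<exists>\<^sub>F n in sequentially. (n \<ge> 1 \<and> \<psi> n \<le> 1 / real b ^ Suc (level n))
        \<and> (n \<ge> 1 \<and> (\<exists>p::int. \<bar>x - real_of_int p / real t ^ n\<bar> < \<psi> n))"
      using psi_le_level by (rule frequently_eventually_conj)
    hence "\<exists>\<^sub>F n in sequentially. \<exists>c\<in>C n. \<bar>x - c\<bar> \<le> r n"
    proof (rule frequently_elim1)
      fix n assume n: "(n \<ge> 1 \<and> \<psi> n \<le> 1 / real b ^ Suc (level n))
        \<and> (n \<ge> 1 \<and> (\<exists>p::int. \<bar>x - real_of_int p / real t ^ n\<bar> < \<psi> n))"
      then obtain p :: int where p: "\<bar>x - real_of_int p / real t ^ n\<bar> < \<psi> n" by blast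
      have "alpha_min b t * real n \<le> alpha_max b t * real n"
        using alpha_less by (intro mult_right_mono) auto
      hence "L n \<le> level n" unfolding L_def level_def by (intro nat_mono ceiling_mono)
      moreover have "alpha_min b t * real n \<le> real (L n)" unfolding L_def by linarith
      moreover have "\<bar>x - real_of_int p / real t ^ n\<bar> < 1 / real b ^ Suc (level n)" using p n by linarith
      ultimately obtain a where "a \<in> PV n \<union> Suc ` PV n" "real_of_int p / real t ^ n = real a / real b ^ L n"
        using approximant_near_missing_digit_set[OF D_sub _ level_ge, of x n "L n" p] x unfolding PV_def by blast
      moreover have "r n = \<psi> n" using n by (simp add: r_def)
      ultimately show "\<exists>c\<in>C n. \<bar>x - c\<bar> \<le> r n"
        using p unfolding C_def by (intro bexI[of _ "real a / real b ^ L n"]) auto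
    qed
    thus "\<exists>\<^sub>\<infinity>n. \<exists>c\<in>C n. \<bar>x - c\<bar> \<le> r n" by (simp add: cofinite_eq_sequentially)
  qed
qed

text \<open>Divergence first forces \<open>s\<close> below the dimension of the digit set. Then
  \<psi> is replaced by powers of \<open>b\<close>, which preserves divergence and yields the
  weights, and digit sequences with runs on \<open>{l n..<m n}\<close> are shown to be well
  approximable.\<close>

lemma measure_infinite:
  assumes div: "\<not> summable (\<lambda>n. \<psi> n powr s * growth ^ n)" and e: "e \<in> D" "e = 0 \<or> e = b - 1"
  shows "hausdorff_measure s (well_approx t \<psi> \<inter> missing_digit_set b D) = \<infinity>"
proof -
  define \<beta> where "\<beta> = real b powr s"
  have beta: "\<beta> \<ge> 1" unfolding \<beta>_def using b_ge s_ge by (simp add: ge_one_powr_ge_zero)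
  define N where "N = real (card D)"
  have N: "N \<ge> 2" using card_D by (simp add: N_def)
  \<comment> \<open>Otherwise the terms are dominated by \<open>\<theta> ^ n\<close>, and \<theta>
    is below 1 because \<open>alpha_min b t\<close> is strictly less than
    \<open>alpha_max b t\<close>; this is where multiplicative independence enters.\<close>
  have small: "\<beta> < N"
  proof (rule ccontr)
    assume "\<not> \<beta> < N"
    define \<theta> where "\<theta> = \<beta> powr - alpha_max b t * growth"
    have "\<theta> \<le> N powr - alpha_max b t * growth"
      unfolding \<theta>_def using \<open>\<not> \<beta> < N\<close> N growth_gt_1 alpha_less alpha_min_pos
      by (intro mult_right_mono powr_mono2') auto
    also have "\<dots> = N powr (alpha_min b t - alpha_max b t)"
      by (simp add: growth_def N_def powr_add[symmetric])
    also have "\<dots> < N powr 0" using N alpha_less by (intro powr_less_mono) auto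
    finally have "\<theta> < 1" using N by simp
    moreover have "\<theta> \<ge> 0" using growth_gt_1 by (simp add: \<theta>_def)
    ultimately have geo: "summable (\<lambda>n. \<theta> ^ n)" by (intro summable_geometric) auto
    have "\<forall>\<^sub>F n in sequentially. norm (\<psi> n powr s * growth ^ n) \<le> \<theta> ^ n"
      using psi_le_power
    proof eventually_elim
      case (elim n)
      have "\<psi> n powr s \<le> ((real b powr - alpha_max b t) ^ n) powr s"
        using elim psi_pos[of n] s_ge by (intro powr_mono2) auto
      also have "\<dots> = (\<beta> powr - alpha_max b t) ^ n"
        using b_ge by (simp add: powr_power_eq \<beta>_def powr_powr mult.commute)
      finally show ?case
        using growth_gt_1 by (simp add: \<theta>_def power_mult_distrib mult_right_mono)
    qed
    hence "summable (\<lambda>n. \<psi> n powr s * growth ^ n)"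
      using geo by (rule summable_comparison_test_ev)
    thus False using div by simp
  qed
  \<comment> \<open>Rounded down so that \<open>b ^ l n\<close> divides
    \<open>t ^ n\<close>.\<close>
  define l where "l n = nat \<lfloor>alpha_min b t * real n\<rfloor>" for n
  have l_le: "real (l n) \<le> alpha_min b t * real n" for n
    using alpha_min_pos by (simp add: l_def)
  have l_gt: "alpha_min b t * real n < real (l n) + 1" for n unfolding l_def by linarith
  have l_lim: "filterlim l at_top sequentially"
    unfolding filterlim_at_top
  proof
    fix S
    show "\<forall>\<^sub>F n in sequentially. S \<le> l n"
      using eventually_ge_at_top[of "nat \<lceil>real S / alpha_min b t\<rceil>"]
    proof eventually_elim
      case (elim n)
      hence "real S / alpha_min b t \<le> real n" by linarith
      hence "real S \<le> alpha_min b t * real n" using alpha_min_pos by (simp add: field_simps)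
      thus "S \<le> l n" unfolding l_def by (rule le_nat_floor)
    qed
  qed
  have "\<forall>\<^sub>F n in sequentially. \<exists>m. n \<ge> 1 \<and> l n \<le> m \<and> 1 / real b ^ m < \<psi> n \<and> \<psi> n \<le> real b / real b ^ m"
    using psi_le_level
  proof eventually_elim
    case (elim n)
    obtain m where m: "m > Suc (level n)" "1 / real b ^ m < \<psi> n" "\<psi> n \<le> real b / real b ^ m"
      using first_power_below[OF b_ge psi_pos[of n], of "level n"] elim by blast
    have "alpha_min b t * real n \<le> alpha_max b t * real n"
      using alpha_less by (intro mult_right_mono) auto
    hence "real (l n) \<le> real (level n)" using l_le[of n] level_ge[of n] by linarith
    hence "l n \<le> m" using m(1) by simp
    thus ?case using m elim by blast
  qed
  then obtain n0 where n0: "\<And>n. n \<ge> n0 \<Longrightarrow>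
      \<exists>m. n \<ge> 1 \<and> l n \<le> m \<and> 1 / real b ^ m < \<psi> n \<and> \<psi> n \<le> real b / real b ^ m"
    unfolding eventually_sequentially by blast
  then obtain m where m: "\<And>n. n \<ge> n0 \<Longrightarrow>
      n \<ge> 1 \<and> l n \<le> m n \<and> 1 / real b ^ m n < \<psi> n \<and> \<psi> n \<le> real b / real b ^ m n"
    by metis
  have ev: "\<forall>\<^sub>F n in sequentially. l n \<le> m n" using m unfolding eventually_sequentially by blast
  \<comment> \<open>By the choice of \<open>m n\<close>, \<open>\<psi> n powr s\<close> is at most
    \<beta> times \<open>(1 / \<beta>) ^ m n\<close>, so summability here would imply summability of
    the original series.\<close>
  have nosum: "\<not> summable (\<lambda>n. growth ^ n * (1 / \<beta>) ^ m n)"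
  proof
    assume "summable (\<lambda>n. growth ^ n * (1 / \<beta>) ^ m n)"
    hence "summable (\<lambda>n. \<beta> * (growth ^ n * (1 / \<beta>) ^ m n))" by (rule summable_mult)
    moreover have "norm (\<psi> n powr s * growth ^ n) \<le> \<beta> * (growth ^ n * (1 / \<beta>) ^ m n)"
      if "n \<ge> n0" for n
    proof -
      have "\<psi> n powr s \<le> (real b / real b ^ m n) powr s"
        using m[OF that] psi_pos[of n] s_ge by (intro powr_mono2) auto
      also have "\<dots> = \<beta> * (1 / \<beta>) ^ m n"
        using b_ge by (simp add: powr_divide powr_power_eq \<beta>_def power_one_over)
      finally show ?thesis
        using growth_gt_1 mult_right_mono[of "\<psi> n powr s" "\<beta> * (1 / \<beta>) ^ m n" "growth ^ n"]
        by (simp add: mult_ac)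
    qed
    ultimately have "summable (\<lambda>n. \<psi> n powr s * growth ^ n)" by (rule summable_comparison_test'[of _ n0])
    thus False using div by simp
  qed
  have C: "growth ^ n * (1 / N) ^ l n \<le> N" for n
  proof -
    have "growth ^ n \<le> N powr (real (l n) + 1)"
      unfolding growth_power N_def[symmetric] using N l_gt[of n] by (intro powr_mono) auto
    also have "\<dots> = N * N ^ l n" using N by (simp add: powr_add powr_realpow)
    finally show ?thesis using N by (simp add: power_one_over field_simps)
  qed
  show ?thesis
  proof (rule hausdorff_measure_limsup_digits[OF b_ge D_lt e(1) s_ge, of l m])
    show "real b powr s < real (card D)" using small by (simp add: \<beta>_def N_def)
    show "\<exists>F c. finite F \<and> (\<forall>n\<in>F. c n \<ge> 0 \<and> S \<le> l n \<and> l n \<le> m n) \<and> sum c F = 1 \<and>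
      (\<forall>k. (\<Sum>n\<in>F. c n * (1 / real (card D)) ^ (l n + (k - m n))) \<le> \<kappa> * (1 / real b powr s) ^ k)"
      if "\<kappa> > 0" for S and \<kappa> :: real
      unfolding N_def[symmetric] \<beta>_def[symmetric]
      by (rule exists_weights[OF growth_gt_1 _ _ _ C l_lim ev nosum that])
        (use N beta small in \<open>auto simp: frac_less2 divide_le_eq_1\<close>)
    fix d x assume d: "\<And>i. d i \<in> D" and run: "\<And>S. \<exists>n. S \<le> l n \<and> (\<forall>i\<in>{l n..<m n}. d i = e)"
      and x: "(\<lambda>i. real (d i) / real b ^ Suc i) sums x"
    have db: "d i < b" for i using d[of i] D_lt by auto
    have xC: "x \<in> missing_digit_set b D" by (rule missing_digit_setI[OF b_ge db d x])
    have "x \<in> well_approx t \<psi>"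
    proof (rule well_approxI)
      show "x \<in> {0..1}" using xC unfolding missing_digit_set_def by blast
      fix n1
      define n2 where "n2 = max n0 n1"
      \<comment> \<open>Runs are supplied with \<open>l n\<close> large; since \<open>l n\<close> is
        at most \<open>alpha_min b t * n\<close>, this start forces \<open>n > n2\<close>.\<close>
      obtain n where n: "Suc (nat \<lceil>alpha_min b t * real n2\<rceil>) \<le> l n" "\<forall>i\<in>{l n..<m n}. d i = e"
        using run by blast
      have "alpha_min b t * real n2 < alpha_min b t * real n" using n(1) l_le[of n] by linarith
      hence "n2 < n" using alpha_min_pos by simp
      hence n': "n \<ge> n0" "n \<ge> n1" by (auto simp: n2_def)
      obtain p :: int where "\<bar>x - real_of_int p / real t ^ n\<bar> \<le> 1 / real b ^ m n"
        using constant_run_approximant[OF db x e(2) _ _ l_le, of n "m n"] n(2) m[OF n'(1)] by blast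
      hence "\<bar>x - real_of_int p / real t ^ n\<bar> < \<psi> n" using m[OF n'(1)] by linarith
      thus "\<exists>n\<ge>n1. n \<ge> 1 \<and> (\<exists>p::int. \<bar>x - real_of_int p / real t ^ n\<bar> < \<psi> n)"
        using n'(2) m[OF n'(1)] by blast
    qed
    thus "x \<in> well_approx t \<psi> \<inter> missing_digit_set b D" using xC by blast
  qed
qed

end

theorem theorem1p2:
  fixes b t :: nat and D :: "nat set" and \<psi> :: "nat \<Rightarrow> real" and s :: real
  assumes "b \<ge> 3" and "t \<ge> 2"
    and "ln (real b) / ln (real t) \<notin> \<rat>"
    and "\<And>q :: nat. prime q \<Longrightarrow> q dvd b \<longleftrightarrow> q dvd t"
    and "D \<subseteq> {0..b - 1}"
    and "card D \<ge> 2"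
    and "0 \<in> D \<or> b - 1 \<in> D"
    and "D \<subseteq> {0..b - 1} - (D1 b t \<union> D2 b t)"
    and "\<And>n. n \<ge> 1 \<Longrightarrow> \<psi> n > 0"
    and "\<forall>\<^sub>F n in sequentially. \<psi> n \<le> real b powi (- \<lceil>alpha_max b t * real n\<rceil> - 1)"
    and "s \<ge> 0"
  shows "hausdorff_measure s (well_approx t \<psi> \<inter> missing_digit_set b D) =
    (if summable (\<lambda>n. \<psi> (Suc n) powr s * real b powr (alpha_min b t * digit_dim b D * real (Suc n)))
     then 0 else \<infinity>)"
proof -
  interpret digit_approximation b t D \<psi> s
    using assms by unfold_locales auto
  \<comment> \<open>The series starts at exponent 1; the extra term at index 0 does not affect
    summability.\<close>
  have eq: "summable (\<lambda>n. \<psi> (Suc n) powr s * real b powr (alpha_min b t * digit_dim b D * real (Suc n)))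
    \<longleftrightarrow> summable (\<lambda>n. \<psi> n powr s * growth ^ n)"
    unfolding powr_dim by (rule summable_Suc_iff[of "\<lambda>n. \<psi> n powr s * growth ^ n"])
  show ?thesis
  proof (cases "summable (\<lambda>n. \<psi> n powr s * growth ^ n)")
    case True
    thus ?thesis unfolding eq by (simp only: if_True measure_zero)
  next
    case False
    obtain e where "e \<in> D" "e = 0 \<or> e = b - 1" using assms(7) by blast
    with False have "hausdorff_measure s (well_approx t \<psi> \<inter> missing_digit_set b D) = \<infinity>"
      by (rule measure_infinite)
    with False show ?thesis unfolding eq by (simp only: if_False)
  qed
qed

end
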